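(* Any simple cubic bipartite counterexample to the Erdős–Gyárfás conjecture has at least $60$ vertices. That is, if $G$ is a simple cubic bipartite graph containing no simple cycle whose length is a power of two, then $|V(G)|\geq 60$.
   Context: Graphs are finite and nonempty. A cubic graph is a graph in which every vertex has degree exactly $3$. The Erdős–Gyárfás conjecture asserts that every finite simple graph of minimum degree at least three contains a simple cycle whose length is a power of two (in a simple graph the relevant lengths are $4,8,16,32,\ldots$). A counterexample is a finite simple graph of minimum degree at least three with no such cycle. *)

theory Defs
  imports "Graph_Theory.Graph_Theory"
begin

text \<open>
  A finite simple graph is a \<^locale>\<open>graph\<close>: a finite symmetric digraph without loops and
  without parallel arcs. An edge between \<open>u\<close> and \<open>v\<close> is the pair of opposite arcs, so
  \<^const>\<open>out_degree\<close> counts each edge at a vertex exactly once and is the undirected degree.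
\<close>

definition cubic :: "('a, 'b) pre_digraph \<Rightarrow> bool" where
  "cubic G \<longleftrightarrow> (\<forall>v \<in> verts G. out_degree G v = 3)"

definition min_degree_ge :: "('a, 'b) pre_digraph \<Rightarrow> nat \<Rightarrow> bool" where
  "min_degree_ge G d \<longleftrightarrow> (\<forall>v \<in> verts G. d \<le> out_degree G v)"

definition bipartite :: "('a, 'b) pre_digraph \<Rightarrow> bool" where
  "bipartite G \<longleftrightarrow> (\<exists>A B. A \<union> B = verts G \<and> A \<inter> B = {} \<and>
     (\<forall>e \<in> arcs G. tail G e \<in> A \<and> head G e \<in> B \<or> tail G e \<in> B \<and> head G e \<in> A))"

text \<open>
  A directed cycle may run along an edge and straight back, which is not a cycle of the
  undirected graph. In a \<^locale>\<open>graph\<close> these are exactly the cycles of length less than 3.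
\<close>

definition simple_cycle :: "('a, 'b) pre_digraph \<Rightarrow> 'b list \<Rightarrow> bool" where
  "simple_cycle G p \<longleftrightarrow> pre_digraph.cycle G p \<and> 3 \<le> length p"

definition erdos_gyarfas_counterexample :: "('a, 'b) pre_digraph \<Rightarrow> bool" where
  "erdos_gyarfas_counterexample G \<longleftrightarrow>
     graph G \<and> verts G \<noteq> {} \<and> min_degree_ge G 3 \<and>
     \<not> (\<exists>p k. simple_cycle G p \<and> length p = 2 ^ k)"

end

theory Submission
  imports Defs
begin

text \<open>
  A counterexample with fewer than 60 vertices has at most 29 vertices on each side of the
  bipartition and no cycle of length 4, 8 or 16. An exhaustive search, which grows a finite piece of
  the graph by branching on the neighbours of one vertex at a time, then excludes in turn: two
  hexagons sharing a path of length 3 (a theta graph), two hexagons sharing an edge, a single hexagon,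
  and finally a single edge. The last step amounts to the observation that a bipartite cubic graph
  without cycles of length 4, 6 and 8 has at least \<open>1 + 6 + 24 = 31\<close> vertices at even distance at most 4
  from any vertex. The search trees were found by computer and are replayed by a verified checker.
\<close>

section \<open>Configurations\<close>

text \<open>Two hexagons that meet in a path of length 2 or 4 leave a cycle of length 8 or 4 as
  symmetric difference, which is forbidden at once. Paths of length 3 and 1 leave cycles of length 6
  and 10, so the theta graph and the fused hexagons are the overlaps that call for a search of their
  own; once refuted, they prune the search from a single hexagon.

  A configuration is sought as a subgraph, not as an induced one. Adding edges or vertices therefore
  never revives a refuted configuration, and whatever contains one is closed by exhibiting the
  embedding. Branching at a vertex \<open>v\<close> is exhaustive because the degree is exactly 3:
  while \<open>v\<close> has fewer known neighbours, a further one exists, and it is either a vertex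
  already present or a new one.

  The trees are replayed by the simplifier, hence by kernel inferences alone, and the data
  structures follow from this: binary labels and tries make lookups short, pattern matching replaces
  conditionals, and a forbidden cycle is coded by a single number.\<close>

text \<open>
  A configuration is a finite piece of the unknown graph. Its vertices are positive binary numbers,
  whose parity gives the side of the bipartition; the trie stores the list of known neighbours
  under the binary expansion of each vertex, most recently added neighbour first.
\<close>

datatype trie = Tip | Bin "num list" trie trie

fun nbs :: "trie \<Rightarrow> num \<Rightarrow> num list" where
  "nbs Tip x = []"
| "nbs (Bin ys l r) num.One = ys"
| "nbs (Bin ys l r) (num.Bit0 x) = nbs l x"
| "nbs (Bin ys l r) (num.Bit1 x) = nbs r x"

fun push :: "num \<Rightarrow> num \<Rightarrow> trie \<Rightarrow> trie" where
  "push y num.One Tip = Bin [y] Tip Tip"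
| "push y (num.Bit0 x) Tip = Bin [] (push y x Tip) Tip"
| "push y (num.Bit1 x) Tip = Bin [] Tip (push y x Tip)"
| "push y num.One (Bin ys l r) = Bin (y # ys) l r"
| "push y (num.Bit0 x) (Bin ys l r) = Bin ys (push y x l) r"
| "push y (num.Bit1 x) (Bin ys l r) = Bin ys l (push y x r)"

fun odd_num :: "num \<Rightarrow> bool" where
  "odd_num num.One = True"
| "odd_num (num.Bit0 x) = False"
| "odd_num (num.Bit1 x) = True"

type_synonym config = "trie \<times> num list"

fun link :: "num \<Rightarrow> num \<Rightarrow> config \<Rightarrow> config" where
  "link x y (t, vs) = (push y x (push x y t), vs)"

text \<open>The last pair is inserted first, so the order of \<open>es\<close> fixes the order of
  the neighbour lists, on which the decoding by \<open>walk\<close> depends. Vertex labels, here and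
  in the certificates, are \<open>nat\<close> literals starting from 2; each is then of the form
  \<open>numeral k\<close>, and \<open>num_of_nat_numeral_eq\<close> makes it binary in one
  rewrite.\<close>

fun build :: "(nat \<times> nat) list \<Rightarrow> num list \<Rightarrow> config" where
  "build [] vs = (Tip, vs)"
| "build ((a, b) # es) vs = link (num_of_nat a) (num_of_nat b) (build es vs)"

text \<open>
  The bits of the last argument, least significant first and up to the leading one, are the turns of
  a walk in a cubic graph that is at \<open>x\<close> and came from \<open>p\<close>. This only serves to decode cycles:
  the resulting list is checked from scratch, so no property of the decoding is needed for soundness.
\<close>

fun walk :: "trie \<Rightarrow> num \<Rightarrow> num \<Rightarrow> num \<Rightarrow> num list" where
  "walk t p x num.One = [x]"
| "walk t p x (num.Bit0 n) = x # walk t x (hd (removeAll p (nbs t x))) n"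
| "walk t p x (num.Bit1 n) = x # walk t x (hd (tl (removeAll p (nbs t x)))) n"

fun closed_path :: "trie \<Rightarrow> num \<Rightarrow> num list \<Rightarrow> bool" where
  "closed_path t z [] = False"
| "closed_path t z [x] = (z \<in> set (nbs t x))"
| "closed_path t z (x # y # ys) = (y \<in> set (nbs t x) \<and> closed_path t z (y # ys))"

fun bad_cycle :: "trie \<Rightarrow> num \<Rightarrow> num list \<Rightarrow> bool" where
  "bad_cycle t v xs = (closed_path t v xs \<and> distinct xs \<and>
     (length xs = 4 \<or> length xs = 8 \<or> length xs = 16))"

text \<open>The walk pretends to arrive at \<open>v\<close> from its newest neighbour. Thus it
  leaves \<open>v\<close> by another edge, and in the certificates, where \<open>v\<close> has just
  been joined to a vertex, the new edge is the one that closes the cycle. The number of binary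
  digits of \<open>n\<close> is the number of vertices: codes 8 to 15 stand for cycles of length 4,
  128 to 255 for length 8, and 32768 to 65535 for length 16.\<close>

fun has_cycle :: "num \<Rightarrow> num \<Rightarrow> config \<Rightarrow> bool" where
  "has_cycle v n (t, vs) = (v \<in> set vs \<and> bad_cycle t v (walk t (hd (nbs t v)) v n))"

text \<open>A conditional by pattern matching, for the same reason as \<open>cons_if\<close>
  below.\<close>

fun select :: "bool \<Rightarrow> num \<Rightarrow> num \<Rightarrow> num" where
  "select True x y = x"
| "select False x y = y"

fun rename :: "(nat \<times> nat) list \<Rightarrow> num \<Rightarrow> num" where
  "rename [] x = x"
| "rename ((a, b) # s) x = select (num_of_nat a = x) (num_of_nat b) (rename s x)"

text \<open>Unprimed data belong to the refuted configuration, primed data to the current one.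
  Adjacency has to be preserved but not reflected.\<close>

fun vertex_ok :: "(nat \<times> nat) list \<Rightarrow> bool \<Rightarrow> trie \<Rightarrow> config \<Rightarrow> num \<Rightarrow> bool" where
  "vertex_ok s b t (t', vs') x = (rename s x \<in> set vs' \<and> (odd_num x = odd_num (rename s x)) = b \<and>
     list_all (\<lambda>y. y \<in> set (nbs t' (rename s x))) (map (rename s) (nbs t x)))"

text \<open>An embedding may exchange the two sides as long as it does so everywhere: the head of
  \<open>vs\<close> decides whether parity is kept or flipped, and the other vertices must agree.
  This suffices since a configuration is refuted for both ways of placing its odd labels.\<close>

fun occurs :: "(nat \<times> nat) list \<Rightarrow> config \<Rightarrow> config \<Rightarrow> bool" where
  "occurs s c (t, vs) = (distinct (map (rename s) vs) \<and>
     list_all (vertex_ok s (odd_num (hd vs) = odd_num (rename s (hd vs))) t c) vs)"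

text \<open>Fewer than 60 vertices and equally many on both sides means at most 29 on each side.\<close>

fun overflow :: "config \<Rightarrow> bool" where
  "overflow (t, vs) = (29 < length (filter odd_num vs) \<or> 29 < length (filter (\<lambda>x. \<not> odd_num x) vs))"

fun room :: "num list \<Rightarrow> bool" where
  "room [] = True"
| "room [a] = True"
| "room [a, b] = True"
| "room (a # b # c # xs) = False"

text \<open>The parity test also rules out \<open>w = v\<close>. A vertex \<open>w\<close> whose
  three neighbours are known can be passed over, since it has no further edge to offer;
  \<open>no_choice\<close> makes this precise.\<close>

fun free :: "trie \<Rightarrow> num \<Rightarrow> num \<Rightarrow> bool" where
  "free t v w = (odd_num w \<noteq> odd_num v \<and> room (nbs t w) \<and> w \<notin> set (nbs t v))"

fun choices :: "num \<Rightarrow> config \<Rightarrow> num list" where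
  "choices v (t, vs) = filter (free t v) vs"

fun attach :: "num \<Rightarrow> num \<Rightarrow> config \<Rightarrow> config" where
  "attach v x (t, vs) = link v x (t, x # vs)"

text \<open>A new label must be absent from the trie as well as from the vertex list, because the
  invariant \<open>well_formed\<close> constrains the trie only at listed vertices. The test for
  \<open>room\<close> before each attachment is what guarantees that \<open>v\<close> really has one
  more neighbour.\<close>

fun fresh :: "num \<Rightarrow> num list \<Rightarrow> config \<Rightarrow> bool" where
  "fresh v [] c = True"
| "fresh v (x # xs) (t, vs) = (x \<notin> set vs \<and> nbs t x = [] \<and> odd_num x \<noteq> odd_num v \<and>
     room (nbs t v) \<and> fresh v xs (attach v x (t, vs)))"

section \<open>Certificates\<close>

text \<open>
  \<open>Known k s\<close> embeds the \<open>k\<close>-th configuration refuted so far, where \<open>s\<close> lists the vertices moved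
  by the embedding. In \<open>Split v ps xs p\<close>, either \<open>v\<close> is joined to one of the vertices that could still
  be its neighbour, refuted by \<open>ps\<close> in this order, or all its missing neighbours are the new vertices
  \<open>xs\<close>. Each configuration refuted by \<open>ps\<close> is known to its later siblings, which is how symmetric
  cases are settled.
\<close>

datatype cert = Cycle nat nat | Known nat "(nat \<times> nat) list" | Overflow
  | Split nat "cert list" "nat list" cert

text \<open>Refuted siblings enter \<open>K\<close> at the front, so \<open>Known 0\<close> is the
  sibling refuted last, and the initial list slides to higher indices as the tree gets deeper. The
  certificates \<open>ps\<close> follow the order of \<open>choices\<close>, that is, newest vertex
  first; a mismatch in number makes \<open>checks\<close> fail, so no candidate can be
  skipped.\<close>

fun check :: "config list \<Rightarrow> config \<Rightarrow> cert \<Rightarrow> bool"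
and checks :: "config list \<Rightarrow> config \<Rightarrow> num \<Rightarrow> num list \<Rightarrow> cert list \<Rightarrow> bool" where
  "check K c (Cycle v n) = has_cycle (num_of_nat v) (num_of_nat n) c"
| "check K c (Known k s) = (k < length K \<and> occurs s c (K ! k))"
| "check K c Overflow = overflow c"
| "check K c (Split v ps xs p) = (num_of_nat v \<in> set (snd c) \<and>
     checks K c (num_of_nat v) (choices (num_of_nat v) c) ps \<and>
     fresh (num_of_nat v) (map num_of_nat xs) c \<and>
     check K (fold (attach (num_of_nat v)) (map num_of_nat xs) c) p)"
| "checks K c v [] [] = True"
| "checks K c v (w # ws) (p # ps) = (check K (link v w c) p \<and> checks (link v w c # K) c v ws ps)"
| "checks K c v [] (p # ps) = False"
| "checks K c v (w # ws) [] = False"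

section \<open>Soundness of the checker\<close>

lemma nbs_push: "nbs (push y x t) z = (if z = x then y # nbs t x else nbs t z)"
  by (induction y x t arbitrary: z rule: push.induct; case_tac z) simp_all

text \<open>Distinctness lets the length of a list count vertices. Symmetry lets one conclude, from
  a complete list at \<open>w\<close> that contains \<open>v\<close>, that \<open>v\<close> has
  \<open>w\<close> recorded too.\<close>

definition well_formed :: "config \<Rightarrow> bool" where
  "well_formed c \<longleftrightarrow> distinct (snd c) \<and> (\<forall>x \<in> set (snd c). distinct (nbs (fst c) x) \<and>
     (\<forall>y \<in> set (nbs (fst c) x). y \<in> set (snd c) \<and> x \<in> set (nbs (fst c) y)))"

lemma well_formedD:
  assumes "well_formed (t, vs)"
  shows "distinct vs" "x \<in> set vs \<Longrightarrow> distinct (nbs t x)"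
    "x \<in> set vs \<Longrightarrow> y \<in> set (nbs t x) \<Longrightarrow> y \<in> set vs"
    "x \<in> set vs \<Longrightarrow> y \<in> set (nbs t x) \<Longrightarrow> x \<in> set (nbs t y)"
  using assms[unfolded well_formed_def fst_conv snd_conv] by blast+

lemma well_formed_link:
  assumes wf: "well_formed (t, vs)"
    and xy: "x \<in> set vs" "y \<in> set vs" "x \<noteq> y" "y \<notin> set (nbs t x)"
  shows "well_formed (link x y (t, vs))"
proof -
  have yx: "x \<notin> set (nbs t y)" using well_formedD(4)[OF wf xy(2)] xy(4) by blast
  show ?thesis
    unfolding well_formed_def link.simps fst_conv snd_conv
  proof (intro conjI ballI)
    show "distinct vs" by (rule well_formedD(1)[OF wf])
  next
    fix z assume z: "z \<in> set vs"
    show "distinct (nbs (push y x (push x y t)) z)"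
      using well_formedD(2)[OF wf z] xy yx by (auto simp: nbs_push)
    fix u assume u: "u \<in> set (nbs (push y x (push x y t)) z)"
    show "u \<in> set vs" using u z xy well_formedD(3)[OF wf z, of u] by (auto simp: nbs_push split: if_splits)
    show "z \<in> set (nbs (push y x (push x y t)) u)"
      using u z xy well_formedD(4)[OF wf z, of u] by (auto simp: nbs_push split: if_splits)
  qed
qed

lemma well_formed_attach:
  assumes "well_formed (t, vs)" "v \<in> set vs" "x \<notin> set vs" "nbs t x = []"
  shows "well_formed (attach v x (t, vs))"
proof -
  have "x \<notin> set (nbs t v)" using well_formedD(3)[OF assms(1,2)] assms(3) by blast
  moreover have "distinct vs" by (rule well_formedD(1)[OF assms(1)])
  with assms(3,4) have "well_formed (t, x # vs)"
    by (auto simp: well_formed_def dest: well_formedD(2-4)[OF assms(1)])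
  ultimately show ?thesis using assms well_formed_link[of t "x # vs" v x] by auto
qed

lemma well_formed_grow:
  "well_formed c \<Longrightarrow> v \<in> set (snd c) \<Longrightarrow> fresh v xs c \<Longrightarrow> well_formed (fold (attach v) xs c)"
proof (induction v xs c rule: fresh.induct)
  case (2 v x xs t vs)
  then have "well_formed (attach v x (t, vs))" by (intro well_formed_attach) auto
  then show ?case using 2 by simp
qed simp

lemma room_iff: "room xs \<longleftrightarrow> length xs < 3"
  by (cases xs rule: room.cases) auto

lemma walk_Cons: "\<exists>ys. walk t p x n = x # ys"
  by (cases n) auto

section \<open>Configurations inside the unknown graph\<close>

text \<open>All that the search uses of a small counterexample. Adjacency is a relation and cycles
  are vertex lists, since this is how configurations present them; arcs return only in the final
  section. The bound \<open>small\<close> speaks of both sides through \<open>b\<close>.\<close>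

locale bipartite_cubic =
  fixes V :: "'a set" and adj :: "'a \<Rightarrow> 'a \<Rightarrow> bool" and left :: "'a \<Rightarrow> bool"
  assumes fin: "finite V"
    and adj_sym: "adj u v \<Longrightarrow> adj v u"
    and adj_V: "adj u v \<Longrightarrow> u \<in> V"
    and adj_left: "adj u v \<Longrightarrow> left u \<noteq> left v"
    and degree: "v \<in> V \<Longrightarrow> card {w. adj v w} = 3"
    and small: "card {v \<in> V. left v = b} \<le> 29"
    and no_cycle: "xs \<noteq> [] \<Longrightarrow> distinct xs \<Longrightarrow> successively adj xs \<Longrightarrow> adj (last xs) (hd xs) \<Longrightarrow>
      length xs \<notin> {4, 8, 16}"
begin

text \<open>The bit \<open>b\<close> tells whether odd labels lie on the left or on the right.
  Vertices not linked in \<open>c\<close> may well have adjacent images, so a realization of a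
  larger configuration restricts to one of every configuration inside it.\<close>

definition realizes :: "(num \<Rightarrow> 'a) \<Rightarrow> bool \<Rightarrow> config \<Rightarrow> bool" where
  "realizes f b c \<longleftrightarrow> inj_on f (set (snd c)) \<and> (\<forall>x \<in> set (snd c). f x \<in> V \<and> left (f x) = (odd_num x = b) \<and>
     (\<forall>y \<in> set (nbs (fst c) x). adj (f x) (f y)))"

definition excluded :: "config \<Rightarrow> bool" where
  "excluded c \<longleftrightarrow> (\<forall>f b. \<not> realizes f b c)"

lemma finite_nb: "v \<in> V \<Longrightarrow> finite {w. adj v w}"
  using degree by (metis card.infinite zero_neq_numeral)

lemma realizes_link:
  assumes "realizes f b (t, vs)" "x \<in> set vs" "y \<in> set vs" "adj (f x) (f y)"
  shows "realizes f b (link x y (t, vs))"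
  using assms adj_sym by (auto simp: realizes_def nbs_push)

lemma realizes_attach:
  assumes "realizes f b (t, vs)" "well_formed (t, vs)" "v \<in> set vs" "x \<notin> set vs" "nbs t x = []"
    "odd_num x \<noteq> odd_num v" "adj (f v) z" "z \<notin> f ` set vs"
  shows "realizes (f(x := z)) b (attach v x (t, vs))"
proof -
  have "\<forall>y \<in> set vs. x \<notin> set (nbs t y)" using well_formedD(3)[OF assms(2)] assms(4) by blast
  moreover have "inj_on (f(x := z)) (set (x # vs))"
    using assms by (auto simp: realizes_def inj_on_def)
  moreover have "z \<in> V" "left z = (odd_num x = b)"
    using assms adj_V[OF adj_sym] adj_left[OF assms(7)] by (auto simp: realizes_def)
  ultimately have "realizes (f(x := z)) b (t, x # vs)"
    using assms by (auto simp: realizes_def)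
  moreover have "v \<noteq> x" using assms(3,4) by auto
  ultimately show ?thesis
    using assms(3,7) realizes_link[of "f(x := z)" b t "x # vs" v x] by (simp del: link.simps)
qed

section \<open>Soundness of the three kinds of leaves\<close>

text \<open>An injective map that preserves adjacency carries a closed path to a cycle of the same
  length.\<close>

lemma has_cycle_sound:
  assumes "well_formed c" "has_cycle v n c"
  shows "excluded c"
  unfolding excluded_def
proof (intro allI notI)
  fix f b
  assume re: "realizes f b c"
  obtain t vs where c: "c = (t, vs)" by (cases c)
  define xs where "xs = walk t (hd (nbs t v)) v n"
  have v: "v \<in> set vs" and cp: "closed_path t v xs" and d: "distinct xs"
    and len: "length xs \<in> {4, 8, 16}"
    using assms(2) by (auto simp: c xs_def)
  have hd: "hd xs = v" unfolding xs_def by (metis walk_Cons list.sel(1))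
  \<comment> \<open>The vertex \<open>z\<close> to which the path returns is kept apart from the
    head of \<open>ys\<close>, because the induction moves the head along the path while the target
    stays.\<close>
  have path: "set ys \<subseteq> set vs \<and> successively adj (map f ys) \<and> adj (last (map f ys)) (f z)"
    if "closed_path t z ys" "hd ys \<in> set vs" for z ys
    using that
  proof (induction ys)
    case (Cons x ys)
    show ?case
    proof (cases ys)
      case Nil
      then show ?thesis using Cons.prems re by (simp add: c realizes_def)
    next
      case (Cons y zs)
      then have y: "y \<in> set (nbs t x)" "x \<in> set vs" "closed_path t z ys"
        using Cons.prems by simp_all
      have "y \<in> set vs" using well_formedD(3) assms(1) y unfolding c by blast
      moreover have "adj (f x) (f y)" using re y by (simp add: c realizes_def)
      ultimately show ?thesis using Cons.IH Cons y by simp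
    qed
  qed simp
  have p: "set xs \<subseteq> set vs" "successively adj (map f xs)" "adj (last (map f xs)) (f v)"
    using path[OF cp] hd v by auto
  have "xs \<noteq> []" using cp by auto
  have "distinct (map f xs)"
    using d re p(1) by (auto simp: distinct_map realizes_def c intro: inj_on_subset)
  from no_cycle[OF _ this p(2)] p(3) len \<open>xs \<noteq> []\<close> hd show False
    by (auto simp: hd_map)
qed

text \<open>A realization of \<open>c\<close> composed with the embedding would realize the refuted
  \<open>c'\<close>.\<close>

lemma occurs_sound:
  assumes "excluded c'" "occurs s c c'"
  shows "excluded c"
  unfolding excluded_def
proof (intro allI notI)
  fix f b
  assume re: "realizes f b c"
  obtain t vs where c: "c = (t, vs)" by (cases c)
  obtain t' vs' where c': "c' = (t', vs')" by (cases c')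
  define d where "d = (odd_num (hd vs') = odd_num (rename s (hd vs')))"
  have dist: "distinct (map (rename s) vs')"
    and ok: "rename s x \<in> set vs \<and> (odd_num x = odd_num (rename s x)) = d \<and>
      (\<forall>y \<in> set (nbs t' x). rename s y \<in> set (nbs t (rename s x)))" if "x \<in> set vs'" for x
    using assms(2) that by (auto simp: c c' d_def list_all_iff)
  have "inj_on (f \<circ> rename s) (set vs')"
    using dist re ok by (intro comp_inj_on) (auto simp: distinct_map realizes_def c intro: inj_on_subset)
  \<comment> \<open>The bit \<open>d\<close> is true when the embedding keeps parity. If it flips
    parity, odd labels of \<open>c'\<close> land where the even ones of \<open>c\<close> do, so the
    side bit changes from \<open>b\<close> to \<open>b = d\<close>.\<close>
  then have "realizes (f \<circ> rename s) (b = d) c'"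
    using re ok by (fastforce simp: realizes_def c c')
  then show False using assms(1) by (auto simp: excluded_def)
qed

lemma overflow_sound:
  assumes "well_formed c" "overflow c"
  shows "excluded c"
  unfolding excluded_def
proof (intro allI notI)
  fix f b
  assume re: "realizes f b c"
  obtain t vs where c: "c = (t, vs)" by (cases c)
  \<comment> \<open>Labels of parity \<open>d\<close> are all sent to the side
    \<open>left v = (d = b)\<close>, whatever the placement \<open>b\<close> is.\<close>
  have bound: "length (filter P vs) \<le> 29" if P: "\<And>x. P x = (odd_num x = d)" for P d
  proof -
    have "inj_on f (set (filter P vs))" using re by (auto simp: c realizes_def intro: inj_on_subset)
    moreover have "distinct vs" using assms(1) well_formedD(1) unfolding c by blast
    ultimately have "length (filter P vs) = card (f ` set (filter P vs))"
      by (simp add: card_image distinct_card del: set_filter)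
    also have "\<dots> \<le> card {v \<in> V. left v = (d = b)}"
      using re fin by (intro card_mono) (auto simp: realizes_def c P)
    finally show ?thesis using small[of "d = b"] by linarith
  qed
  show False using assms(2) bound[of odd_num True] bound[of "\<lambda>x. \<not> odd_num x" False] by (auto simp: c)
qed

section \<open>Exhaustiveness of the branching at a vertex\<close>

text \<open>This is what allows the length of a known neighbour list to be compared with the degree
  3.\<close>

lemma realizes_nbs:
  assumes "realizes f b (t, vs)" "well_formed (t, vs)" "v \<in> set vs"
  shows "f ` set (nbs t v) \<subseteq> {w. adj (f v) w}" "card (f ` set (nbs t v)) = length (nbs t v)"
proof -
  have "set (nbs t v) \<subseteq> set vs" using well_formedD(3)[OF assms(2,3)] by blast
  then have "inj_on f (set (nbs t v))" using assms(1) by (auto simp: realizes_def intro: inj_on_subset)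
  then show "card (f ` set (nbs t v)) = length (nbs t v)"
    using well_formedD(2)[OF assms(2,3)] by (simp add: card_image distinct_card)
  show "f ` set (nbs t v) \<subseteq> {w. adj (f v) w}" using assms by (auto simp: realizes_def)
qed

text \<open>The last assumption says that every neighbour of \<open>f v\<close> inside the image is
  already recorded. Fewer than three are recorded, so by counting there is an unrecorded neighbour
  \<open>z\<close>; it lies outside the image and can serve as the image of the new label.\<close>

lemma grow_realizes:
  assumes "well_formed c" "v \<in> set (snd c)" "fresh v xs c" "realizes f b c"
    and "\<And>z. adj (f v) z \<Longrightarrow> z \<in> f ` set (snd c) \<Longrightarrow> z \<in> f ` set (nbs (fst c) v)"
  shows "\<exists>f. realizes f b (fold (attach v) xs c)"
  using assms
proof (induction v xs c arbitrary: f rule: fresh.induct)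
  case (2 v x xs t vs)
  note re = \<open>realizes f b (t, vs)\<close> and wf = \<open>well_formed (t, vs)\<close>
  have v: "v \<in> set vs" and fr: "x \<notin> set vs" "nbs t x = []" "odd_num x \<noteq> odd_num v"
    and room: "length (nbs t v) < 3" and rest: "fresh v xs (attach v x (t, vs))"
    using 2 by (auto simp: room_iff)
  have fv: "f v \<in> V" using re v by (simp add: realizes_def)
  have "card (f ` set (nbs t v)) < card {w. adj (f v) w}"
    using realizes_nbs(2)[OF re wf v] degree[OF fv] room by simp
  then obtain z where z: "adj (f v) z" "z \<notin> f ` set (nbs t v)"
    using card_mono[of "f ` set (nbs t v)" "{w. adj (f v) w}"] by fastforce
  then have zv: "z \<notin> f ` set vs" using 2(6) by auto
  have vx: "v \<noteq> x" using v fr by auto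
  have wf': "well_formed (attach v x (t, vs))" by (rule well_formed_attach[OF wf v fr(1,2)])
  have re': "realizes (f(x := z)) b (attach v x (t, vs))"
    by (rule realizes_attach[OF re wf v fr z(1) zv])
  have "x \<notin> set (nbs t v)" using well_formedD(3)[OF wf v] fr(1) by blast
  \<comment> \<open>The assumption survives the step: the only point added to the image is
    \<open>z\<close>, and the new label \<open>x\<close> with image \<open>z\<close> is now recorded
    as a neighbour of \<open>v\<close>.\<close>
  then have "y \<in> (f(x := z)) ` set (nbs (fst (attach v x (t, vs))) v)"
    if "adj ((f(x := z)) v) y" "y \<in> (f(x := z)) ` set (snd (attach v x (t, vs)))" for y
    using that 2(6)[of y] fr(1) vx by (auto simp: nbs_push image_iff split: if_splits)
  from 2(1)[OF wf' _ rest re' this] v show ?case by simp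
qed auto

text \<open>Suppose that \<open>z = f w\<close> is a neighbour of \<open>f v\<close> but
  \<open>w\<close> is not recorded at \<open>v\<close>. If \<open>w\<close> has room, it is among
  the choices and the link is refuted. If \<open>w\<close> is full, its recorded neighbours are all
  its neighbours in the graph; one of them has image \<open>f v\<close>, so by injectivity it is
  \<open>v\<close>, and symmetry records \<open>w\<close> at \<open>v\<close> after all.\<close>

lemma no_choice:
  assumes "well_formed (t, vs)" "realizes f b (t, vs)" "v \<in> set vs"
    and "\<And>w. w \<in> set (choices v (t, vs)) \<Longrightarrow> excluded (link v w (t, vs))"
    and "adj (f v) z" "z \<in> f ` set vs"
  shows "z \<in> f ` set (nbs t v)"
proof (rule ccontr)
  assume z: "z \<notin> f ` set (nbs t v)"
  obtain w where w: "w \<in> set vs" "z = f w" using assms(6) by auto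
  have "\<not> room (nbs t w)"
  proof
    assume "room (nbs t w)"
    moreover have "odd_num w \<noteq> odd_num v"
      using adj_left[OF assms(5)] assms(2,3) w by (auto simp: realizes_def)
    ultimately have "excluded (link v w (t, vs))" using assms(4) w z by auto
    then show False using realizes_link[OF assms(2,3) w(1)] assms(5) w(2) by (auto simp: excluded_def)
  qed
  \<comment> \<open>Three distinct recorded neighbours exhaust the three neighbours of
    \<open>f w\<close>.\<close>
  then have "3 \<le> length (nbs t w)" by (simp add: room_iff)
  moreover have fw: "f w \<in> V" using w assms(2) by (simp add: realizes_def)
  ultimately have "f ` set (nbs t w) = {u. adj (f w) u}"
    using realizes_nbs[OF assms(2,1) w(1)] degree[OF fw] finite_nb[OF fw] by (intro card_seteq) auto
  moreover have "adj (f w) (f v)" using assms(5) w adj_sym by simp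
  ultimately obtain u where u: "u \<in> set (nbs t w)" "f v = f u" by auto
  have "u \<in> set vs" "w \<in> set (nbs t u)" using well_formedD(3,4)[OF assms(1) w(1)] u(1) by auto
  moreover then have "u = v" using u(2) assms(2,3) by (auto simp: realizes_def inj_on_def)
  ultimately show False using z w by auto
qed

section \<open>Soundness of whole certificates\<close>

text \<open>The second statement is the invariant of the run over the candidates. Keeping
  \<open>ws\<close> within the choices for \<open>c\<close> provides a vertex distinct from
  \<open>v\<close> and not yet joined to it, so that each linked configuration is well-formed and
  the first statement applies to it.\<close>

lemma check_sound:
  "\<lbrakk>\<forall>k \<in> set K. excluded k; well_formed c; check K c p\<rbrakk> \<Longrightarrow> excluded c"
  "\<lbrakk>\<forall>k \<in> set K. excluded k; well_formed c; v \<in> set (snd c);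
    set ws \<subseteq> set (choices v c); checks K c v ws ps\<rbrakk> \<Longrightarrow> \<forall>w \<in> set ws. excluded (link v w c)"
proof (induction K c p and K c v ws ps rule: check_checks.induct)
  case (1 K c v n)
  then show ?case using has_cycle_sound by auto
next
  case (2 K c k s)
  then show ?case using occurs_sound[of "K ! k" s c] by auto
next
  case (3 K c)
  then show ?case using overflow_sound by auto
next
  case (4 K c v ps xs p)
  obtain t vs where c: "c = (t, vs)" by (cases c)
  let ?v = "num_of_nat v" and ?xs = "map num_of_nat xs"
  have v: "?v \<in> set (snd c)" and fr: "fresh ?v ?xs c"
    and ch: "\<forall>w \<in> set (choices ?v c). excluded (link ?v w c)"
    and p: "check K (fold (attach ?v) ?xs c) p"
    using 4 by auto
  have ex: "excluded (fold (attach ?v) ?xs c)"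
    using 4(2)[OF 4(3) well_formed_grow[OF 4(4) v fr] p] .
  show ?case unfolding excluded_def
  proof (intro allI notI)
    fix f b
    assume re: "realizes f b c"
    \<comment> \<open>With every link refuted, \<open>no_choice\<close> supplies the assumption of
      \<open>grow_realizes\<close>: the missing neighbours of \<open>v\<close> can only be new
      vertices. A realization of \<open>c\<close> thus extends to the grown configuration.\<close>
    have "\<exists>f. realizes f b (fold (attach ?v) ?xs c)"
      using no_choice[of t vs f b ?v] 4(4) re v ch
      by (intro grow_realizes[OF 4(4) v fr re]) (auto simp: c)
    then show False using ex by (auto simp: excluded_def)
  qed
next
  case (6 K c v w ws p ps)
  obtain t vs where c: "c = (t, vs)" by (cases c)
  have w: "w \<in> set vs" "w \<noteq> v" "w \<notin> set (nbs t v)" using 6(6) by (auto simp: c)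
  have "well_formed (link v w c)" using 6(4,5) w unfolding c by (intro well_formed_link) auto
  \<comment> \<open>Having been refuted, this configuration may join \<open>K\<close>, which is what
    the induction hypothesis for the remaining candidates asks for.\<close>
  then have ex: "excluded (link v w c)" using 6(1,3,7) by simp
  then show ?case using 6(2) 6(3-7) by auto
qed auto

end

section \<open>The search trees\<close>

text \<open>The vertices 2 and 5 are joined by three paths of length 3, with inner vertices 3, 4 and
  7, 6 and 9, 8.\<close>

definition theta :: config where
  "theta = build
    [(8, 5), (9, 8), (2, 9), (7, 2), (6, 7), (5, 6), (4, 5), (3, 4), (2, 3)]
    (map num_of_nat [9, 8, 7, 6, 5, 4, 3, 2])"

text \<open>The hexagons 2, 3, 4, 5, 6, 7 and 2, 3, 10, 11, 8, 9 share the edge from 2 to 3.\<close>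

definition fused_hexagons :: config where
  "fused_hexagons = build
    [(10, 3), (11, 10), (8, 11), (9, 8), (2, 9), (7, 2), (6, 7), (5, 6), (4, 5), (3, 4), (2, 3)]
    (map num_of_nat [11, 10, 9, 8, 7, 6, 5, 4, 3, 2])"

definition hexagon :: config where
  "hexagon = build
    [(7, 2), (6, 7), (5, 6), (4, 5), (3, 4), (2, 3)]
    (map num_of_nat [7, 6, 5, 4, 3, 2])"

definition single_edge :: config where
  "single_edge = build
    [(2, 3)]
    (map num_of_nat [3, 2])"

lemma well_formed_configs:
  "well_formed theta" "well_formed fused_hexagons" "well_formed hexagon" "well_formed single_edge"
  by (simp_all add: well_formed_def theta_def fused_hexagons_def hexagon_def single_edge_def)

text \<open>
  The checker is evaluated by rewriting. The simplifier would normalise the condition of an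
  \<open>if\<close> afresh, including the whole configuration occurring in it; pattern matching avoids this.
\<close>

fun cons_if :: "bool \<Rightarrow> 'a \<Rightarrow> 'a list \<Rightarrow> 'a list" where
  "cons_if True x xs = x # xs"
| "cons_if False x xs = xs"

lemma filter_Cons_eval: "filter P (x # xs) = cons_if (P x) x (filter P xs)"
  by simp

lemma mem_eval: "x \<in> set [] \<longleftrightarrow> False" "x \<in> set (y # ys) \<longleftrightarrow> x = y \<or> x \<in> set ys"
  by simp_all

text \<open>Lengths evaluate to towers of \<open>Suc\<close>, while the bounds, the cycle lengths
  and the indices are numerals. The two are compared by cancelling one \<open>Suc\<close> against
  one \<open>pred_numeral\<close> at a time. The literal 1 has rules of its own because
  \<open>numeral_One\<close> is among the rewrite rules.\<close>

lemma nat_eval: "(0 :: nat) < Suc n" "(1 < Suc n) = (0 < n)" "(numeral k < Suc n) = (pred_numeral k < n)" "(i < (0 :: nat)) = False"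
  "(Suc n = numeral k) = (n = pred_numeral k)" "((0::nat) = 0) = True" "((0::nat) = numeral k) = False" "(Suc n = 0) = False"
  "(x # xs) ! 0 = x" "(x # xs) ! 1 = xs ! 0" "(x # xs) ! numeral k = xs ! pred_numeral k" "(Suc n = 1) = (n = 0)" "((0::nat) = 1) = False"
  by (simp_all add: numeral_eq_Suc)

text \<open>Used with \<open>simp only\<close>, these turn the simplifier into an interpreter of the
  checker. \<open>Num.BitM.simps\<close> computes the predecessors of even numerals that
  \<open>pred_numeral_simps\<close> leaves behind.\<close>

lemmas eval = nbs.simps push.simps odd_num.simps link.simps build.simps walk.simps closed_path.simps
  bad_cycle.simps has_cycle.simps select.simps rename.simps vertex_ok.simps occurs.simps overflow.simps
  room.simps free.simps choices.simps attach.simps fresh.simps check.simps checks.simps cons_if.simps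
  num_of_nat_numeral_eq eq_num_simps pred_numeral_simps numeral_One Num.BitM.simps simp_thms if_True if_False
  list.map list.sel list.size list.pred_inject list.distinct distinct.simps removeAll.simps filter.simps(1) filter_Cons_eval
  mem_eval nat_eval fold_simps snd_conv add_0_right add_Suc_right plus_nat.add_0

section \<open>Refutation of the four pieces\<close>

text \<open>Nothing is known at the start, so \<open>Known\<close> refers to refuted siblings only.
  The first six splits treat the vertices of degree 2: every edge to an old vertex closes a
  forbidden cycle, so each gets a new neighbour of its own. The first real branching occurs at 16,
  which is joined to 23; joining it to 21 instead is settled by the symmetry exchanging 21 and 23,
  both attached to 12.\<close>

lemma check_theta: "check [] theta
   (Split 6 [Cycle 6 9, Cycle 6 11] [11] (Split 3 [Cycle 3 9] [10] (Split 4 [Cycle 4 10, Cycle 4 11, Cycle 4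
    15] [13] (Split 7 [Cycle 7 10, Cycle 7 11] [12] (Split 8 [Cycle 8 10, Cycle 8 8] [15] (Split 9 [Cycle 9 9,
    Cycle 9 11] [14] (Split 11 [Cycle 11 158, Cycle 11 8, Cycle 11 186] [16,18] (Split 10 [Cycle 10 158, Cycle
    10 8] [17,19] (Split 13 [Cycle 13 158, Cycle 13 222, Cycle 13 156, Cycle 13 152] [20,22] (Split 12 [Cycle
    12 158, Cycle 12 222, Cycle 12 156] [21,23] (Split 15 [Cycle 15 158, Cycle 15 222, Cycle 15 150, Cycle 15
    214, Cycle 15 10] [24,26] (Split 14 [Cycle 14 148, Cycle 14 212, Cycle 14 156, Cycle 14 220] [25,27]
    (Split 16 [Cycle 16 150, Cycle 16 214, Split 18 [Cycle 18 150, Cycle 18 214, Cycle 18 8, Split 16 [Cycle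
    16 151, Cycle 16 215, Cycle 16 9, Cycle 16 159, Cycle 16 223] [29] (Split 18 [Cycle 18 9, Cycle 18 151,
    Cycle 18 215, Cycle 18 13, Cycle 18 159, Cycle 18 223] [31] (Split 21 [Cycle 21 143, Cycle 21 207, Cycle
    21 159, Cycle 21 223] [28] (Split 23 [Cycle 23 9, Cycle 23 143, Cycle 23 207, Cycle 23 159, Cycle 23 223]
    [30] (Split 29 [Cycle 29 8, Cycle 29 166, Cycle 29 142, Cycle 29 206, Cycle 29 158, Cycle 29 222] [32,34]
    (Split 31 [Cycle 31 148, Cycle 31 212, Cycle 31 134, Cycle 31 8, Cycle 31 142, Cycle 31 206, Cycle 31 158,
    Cycle 31 222] [36,38] (Split 28 [Cycle 28 134, Cycle 28 198, Cycle 28 150, Cycle 28 214] [33,35] (Split 36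
    [ Split 25 [Cycle 25 33534, Cycle 25 52478, Cycle 25 36606, Cycle 25 52990, Cycle 25 134, Split 32 [Cycle
    32 150, Cycle 32 214, Cycle 32 33534, Cycle 32 53238, Cycle 32 39966, Cycle 32 56350] [37,39] (Split 36
    [Cycle 36 167, Cycle 36 231, Cycle 36 8, Cycle 36 33535, Cycle 36 53239, Cycle 36 39967, Cycle 36 56351]
    [41] (Split 41 [Cycle 41 10, Cycle 41 142, Cycle 41 174, Cycle 41 43998, Cycle 41 35326, Cycle 41 40174,
    Cycle 41 56558] [40,42] (Split 25 [Cycle 25 38655, Cycle 25 55039, Cycle 25 41727, Cycle 25 36607, Cycle
    25 135, Cycle 25 8, Cycle 25 159, Cycle 25 223] [44] (Split 26 [Cycle 26 43519, Cycle 26 59903, Cycle 26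
    60927, Cycle 26 52991, Cycle 26 10, Cycle 26 159, Cycle 26 223] [43] (Split 34 [Cycle 34 46574, Cycle 34
    8, Cycle 34 12, Cycle 34 150, Cycle 34 214, Cycle 34 45822, Cycle 34 40734, Cycle 34 57118] [45,47] (Split
    35 [Cycle 35 42495, Cycle 35 8, Cycle 35 12, Cycle 35 10, Cycle 35 171, Cycle 35 47615, Cycle 35 38799,
    Cycle 35 55183] [46] (Split 40 [Cycle 40 35034, Cycle 40 51418, Cycle 40 35838, Cycle 40 43226, Cycle 40
    59610, Cycle 40 206, Cycle 40 38846, Cycle 40 40638, Cycle 40 57022] [49,51] (Split 42 [Cycle 42 8, Cycle
    42 12, Cycle 42 35034, Cycle 42 51418, Cycle 42 35838, Cycle 42 43226, Cycle 42 59610, Cycle 42 206, Cycle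
    42 38846, Cycle 42 40638, Cycle 42 57022] [53,55] (Split 44 [Cycle 44 35070, Cycle 44 51454, Cycle 44
    43262, Cycle 44 59646, Cycle 44 35326, Cycle 44 51710, Cycle 44 8, Cycle 44 43518, Cycle 44 59902, Cycle
    44 52990, Cycle 44 10, Cycle 44 158, Cycle 44 222] [57,59] (Split 24 [Cycle 24 150, Cycle 24 214, Cycle 24
    35070, Cycle 24 51454, Cycle 24 43262, Cycle 24 59646, Cycle 24 35326, Cycle 24 51710, Cycle 24 8, Cycle
    24 43518, Cycle 24 59902, Cycle 24 52990, Split 24 [Cycle 24 151, Cycle 24 215, Cycle 24 35071, Cycle 24
    51455, Cycle 24 43263, Cycle 24 59647, Cycle 24 35327, Cycle 24 51711, Cycle 24 9, Cycle 24 43519, Cycle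
    24 59903, Cycle 24 52991, Cycle 24 159, Cycle 24 223] [61] Overflow, Cycle 24 158, Cycle 24 222] [61,63]
    Overflow)))))))))), Known 0 [(24,26),(26,24)], Cycle 25 158, Cycle 25 222] [40,42] (Split 32 [Cycle 32
    150, Cycle 32 214, Cycle 32 36854, Cycle 32 40438, Cycle 32 56822] [37,39] (Split 35 [Cycle 35 42999,
    Cycle 35 59383, Cycle 35 8, Cycle 35 151, Cycle 35 171, Cycle 35 38903, Cycle 35 55287, Cycle 35 40695,
    Cycle 35 57079] [44] (Split 36 [Cycle 36 167, Cycle 36 231, Cycle 36 10, Cycle 36 36855, Cycle 36 40439,
    Cycle 36 56823] [41] (Split 34 [Cycle 34 166, Cycle 34 8, Cycle 34 12, Cycle 34 214, Cycle 34 36854, Cycle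
    34 40438, Cycle 34 56822] [43,45] (Split 40 [Cycle 40 35326, Cycle 40 51710, Cycle 40 44542, Cycle 40
    43518, Cycle 40 59902, Cycle 40 52990, Cycle 40 10, Cycle 40 158, Cycle 40 222] [47,49] (Split 42 [Cycle
    42 8, Cycle 42 12, Cycle 42 35326, Cycle 42 51710, Cycle 42 44542, Cycle 42 43518, Cycle 42 59902, Cycle
    42 52990, Cycle 42 10, Cycle 42 158, Cycle 42 222] [51,53] (Split 44 [Cycle 44 37886, Cycle 44 54270,
    Cycle 44 46078, Cycle 44 62462, Cycle 44 35806, Cycle 44 52190, Cycle 44 8, Cycle 44 43998, Cycle 44
    60382, Cycle 44 10, Cycle 44 36846, Cycle 44 40430, Cycle 44 56814] [55,57] (Split 24 [Cycle 24 34302,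
    Cycle 24 50686, Cycle 24 150, Cycle 24 214, Cycle 24 182, Cycle 24 246, Cycle 24 35326, Cycle 24 51710,
    Cycle 24 44542, Cycle 24 43518, Cycle 24 59902, Cycle 24 52990, Split 26 [Cycle 26 34302, Cycle 26 50686,
    Cycle 26 150, Cycle 26 214, Cycle 26 182, Cycle 26 246, Cycle 26 35326, Cycle 26 51710, Cycle 26 44542,
    Cycle 26 43518, Cycle 26 59902, Cycle 26 52990, Cycle 26 8, Cycle 26 158, Cycle 26 222] [59,61] Overflow,
    Cycle 24 158, Cycle 24 222] [59,61] Overflow)))))))), Known 0 [(33,35),(35,33)], Cycle 36 36854, Cycle 36
    53238, Cycle 36 40438, Cycle 36 56822] [37,39] (Split 20 [Cycle 20 43966, Cycle 20 60350, Cycle 20 36462,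
    Cycle 20 52846, Cycle 20 142, Cycle 20 206, Split 37 [Cycle 37 10, Cycle 37 142, Cycle 37 206, Cycle 37
    174, Cycle 37 36590, Cycle 37 52974, Cycle 37 33726, Cycle 37 36702] [40,42] (Split 19 [Cycle 19 46559,
    Cycle 19 62943, Cycle 19 36023, Cycle 19 36535, Cycle 19 52919, Cycle 19 143, Cycle 19 151, Cycle 19 215,
    Cycle 19 8] [44] (Split 20 [Cycle 20 43967, Cycle 20 36463, Cycle 20 52847, Cycle 20 143, Cycle 20 207,
    Cycle 20 10] [41] (Split 30 [Cycle 30 44922, Cycle 30 170, Cycle 30 148, Cycle 30 212, Cycle 30 134, Cycle
    30 198, Cycle 30 214] [43,45] (Split 39 [Cycle 39 47038, Cycle 39 8, Cycle 39 12, Cycle 39 10, Cycle 39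
    142, Cycle 39 206, Cycle 39 36590, Cycle 39 52974, Cycle 39 46014] [46,48] (Split 40 [Cycle 40 34814,
    Cycle 40 51198, Cycle 40 44926, Cycle 40 142, Cycle 40 206, Cycle 40 38846, Cycle 40 55230, Cycle 40
    48062] [47,49] (Split 42 [Cycle 42 8, Cycle 42 12, Cycle 42 34814, Cycle 42 51198, Cycle 42 44926, Cycle
    42 142, Cycle 42 206, Cycle 42 38846, Cycle 42 55230, Cycle 42 48062] [51,53] (Split 44 [Cycle 44 39326,
    Cycle 44 55710, Cycle 44 47518, Cycle 44 63902, Cycle 44 35950, Cycle 44 52334, Cycle 44 8, Cycle 44
    36462, Cycle 44 52846, Cycle 44 142, Cycle 44 206, Cycle 44 10] [55,57] (Split 22 [Cycle 22 134, Cycle 22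
    198, Cycle 22 39326, Cycle 22 55710, Cycle 22 47518, Cycle 22 63902, Cycle 22 35950, Cycle 22 52334, Cycle
    22 8, Cycle 22 36462, Cycle 22 52846, Cycle 22 142, Cycle 22 206, Split 17 [Cycle 17 38367, Cycle 17
    54751, Cycle 17 36023, Cycle 17 36535, Cycle 17 52919, Cycle 17 151, Cycle 17 215] [50] (Split 50 [Cycle
    50 144, Cycle 50 208, Cycle 50 39326, Cycle 50 55710, Cycle 50 47518, Cycle 50 63902, Cycle 50 35950,
    Cycle 50 52334, Cycle 50 166, Cycle 50 36462, Cycle 50 52846, Cycle 50 142, Cycle 50 206] [59,61]
    Overflow)] [59,61] Overflow)))))))), Known 0 [(17,19),(19,17)]] [41,43] (Split 30 [Cycle 30 44922, Cycle
    30 61306, Cycle 30 170, Cycle 30 234, Cycle 30 148, Cycle 30 212, Cycle 30 134, Cycle 30 198, Cycle 30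
    150, Cycle 30 214] [45,47] (Split 37 [Cycle 37 10, Cycle 37 142, Cycle 37 206, Cycle 37 36590, Cycle 37
    52974, Cycle 37 40174] [40,42] (Split 39 [Cycle 39 8, Cycle 39 12, Cycle 39 10, Cycle 39 142, Cycle 39
    206, Cycle 39 36590, Cycle 39 52974, Cycle 39 40174] [44,46] (Split 41 [Cycle 41 37694, Cycle 41 54078,
    Cycle 41 45886, Cycle 41 62270, Cycle 41 38782, Cycle 41 38526, Cycle 41 54910, Cycle 41 134, Cycle 41
    198, Cycle 41 10] [48,50] (Split 43 [Cycle 43 8, Cycle 43 12, Cycle 43 37694, Cycle 43 54078, Cycle 43
    45886, Cycle 43 62270, Cycle 43 38782, Cycle 43 38526, Cycle 43 54910, Cycle 43 134, Cycle 43 198, Cycle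
    43 10] [52,54] (Split 40 [Cycle 40 34814, Cycle 40 51198, Cycle 40 142, Cycle 40 206, Cycle 40 38846,
    Cycle 40 55230, Cycle 40 40638, Cycle 40 57022] [49,51] (Split 42 [Cycle 42 8, Cycle 42 12, Cycle 42
    34814, Cycle 42 51198, Cycle 42 142, Cycle 42 206, Cycle 42 38846, Cycle 42 55230, Cycle 42 40638, Cycle
    42 57022] [53,55] (Split 48 [Cycle 48 39166, Cycle 48 55550, Cycle 48 47358, Cycle 48 63742, Cycle 48
    36094, Cycle 48 52478, Cycle 48 36606, Cycle 48 52990, Cycle 48 34734, Cycle 48 51118, Cycle 48 158, Cycle
    48 222] [57,59] (Split 50 [Cycle 50 8, Cycle 50 12, Cycle 50 39166, Cycle 50 55550, Cycle 50 47358, Cycle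
    50 63742, Cycle 50 36094, Cycle 50 52478, Cycle 50 36606, Cycle 50 52990, Cycle 50 34734, Cycle 50 51118,
    Cycle 50 158, Cycle 50 222] [61,63] Overflow))))))))))))))))), Cycle 18 158, Cycle 18 222] [29,31] (Split
    16 [Cycle 16 9, Cycle 16 13, Cycle 16 151, Cycle 16 215, Cycle 16 8, Cycle 16 159, Cycle 16 223] [33]
    (Split 21 [Cycle 21 142, Cycle 21 206, Cycle 21 158, Cycle 21 222] [28,30] (Split 23 [Cycle 23 9, Cycle 23
    13, Cycle 23 143, Cycle 23 207, Cycle 23 159, Cycle 23 223] [32] (Split 29 [Cycle 29 134, Cycle 29 166,
    Cycle 29 230, Cycle 29 142, Cycle 29 206, Cycle 29 158, Cycle 29 222] [34,36] (Split 31 [Cycle 31 8, Cycle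
    31 12, Cycle 31 134, Cycle 31 166, Cycle 31 230, Cycle 31 142, Cycle 31 206, Cycle 31 158, Cycle 31 222]
    [38,40] (Split 33 [ Split 33 [Cycle 33 8, Split 28 [Cycle 28 134, Cycle 28 198, Cycle 28 150, Cycle 28
    214] [35,37] (Split 30 [Cycle 30 8, Cycle 30 12, Cycle 30 134, Cycle 30 198, Cycle 30 150, Cycle 30 214]
    [39,41] (Split 34 [Cycle 34 38904, Cycle 34 55288, Cycle 34 47096, Cycle 34 63480, Cycle 34 36854, Cycle
    34 53238, Cycle 34 40438, Cycle 34 56822] [43,45] (Split 36 [Cycle 36 9, Cycle 36 13, Cycle 36 138, Cycle
    36 202, Cycle 36 170, Cycle 36 234, Cycle 36 36855, Cycle 36 53239, Cycle 36 40439, Cycle 36 56823] [47]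
    (Split 38 [Cycle 38 134, Cycle 38 144, Cycle 38 208, Cycle 38 38904, Cycle 38 55288, Cycle 38 47096, Cycle
    38 63480, Cycle 38 36854, Cycle 38 53238, Cycle 38 40438, Cycle 38 56822] [49,51] (Split 40 [Cycle 40 9,
    Cycle 40 13, Cycle 40 8, Cycle 40 182, Cycle 40 246, Cycle 40 138, Cycle 40 202, Cycle 40 170, Cycle 40
    234, Cycle 40 36855, Cycle 40 53239, Cycle 40 40439, Cycle 40 56823] [53] (Split 43 [Cycle 43 174, Cycle
    43 36590, Cycle 43 52974, Cycle 43 40174, Cycle 43 56558] [42,44] (Split 45 [Cycle 45 8, Cycle 45 12,
    Cycle 45 174, Cycle 45 36590, Cycle 45 52974, Cycle 45 40174, Cycle 45 56558] [46,48] (Split 49 [Cycle 49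
    150, Cycle 49 214, Cycle 49 182, Cycle 49 246, Cycle 49 174, Cycle 49 36590, Cycle 49 52974, Cycle 49
    40174, Cycle 49 56558] [50,52] (Split 51 [Cycle 51 8, Cycle 51 12, Cycle 51 150, Cycle 51 214, Cycle 51
    182, Cycle 51 246, Cycle 51 174, Cycle 51 36590, Cycle 51 52974, Cycle 51 40174, Cycle 51 56558] [54,56]
    (Split 35 [Cycle 35 38494, Cycle 35 54878, Cycle 35 46686, Cycle 35 63070, Cycle 35 38750, Cycle 35 55134,
    Cycle 35 46942, Cycle 35 63326, Split 37 [Cycle 37 38494, Cycle 37 54878, Cycle 37 46686, Cycle 37 63070,
    Cycle 37 38750, Cycle 37 55134, Cycle 37 46942, Cycle 37 63326, Cycle 37 8, Cycle 37 38902, Cycle 37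
    55286, Cycle 37 40694, Cycle 37 57078] [58,60] Overflow, Cycle 35 38902, Cycle 35 55286, Cycle 35 40694,
    Cycle 35 57078] [58,60] Overflow)))))))))), Known 0 [(34,36),(36,34)], Cycle 33 9, Cycle 33 167, Cycle 33
    231, Cycle 33 143, Cycle 33 207, Cycle 33 159, Cycle 33 223] [42] (Split 40 [Cycle 40 36855, Cycle 40
    53239, Cycle 40 40439, Cycle 40 56823] [35] (Split 28 [Cycle 28 170, Cycle 28 134, Cycle 28 198, Cycle 28
    150, Cycle 28 214] [37,39] (Split 30 [Cycle 30 8, Cycle 30 12, Cycle 30 170, Cycle 30 134, Cycle 30 198,
    Cycle 30 150, Cycle 30 214] [41,43] (Split 38 [Cycle 38 38908, Cycle 38 55292, Cycle 38 47100, Cycle 38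
    63484, Cycle 38 8, Cycle 38 36854, Cycle 38 53238, Cycle 38 40438, Cycle 38 56822] [45,47] (Split 42
    [Cycle 42 166, Cycle 42 230, Cycle 42 138, Cycle 42 202, Cycle 42 170, Cycle 42 234, Cycle 42 8, Cycle 42
    38844, Cycle 42 55228, Cycle 42 40636, Cycle 42 57020] [49,51] (Split 35 [Cycle 35 172, Cycle 35 236,
    Cycle 35 174, Cycle 35 36590, Cycle 35 52974, Cycle 35 40174, Cycle 35 56558] [44,46] (Split 20 [Cycle 20
    37278, Cycle 20 53662, Cycle 20 39534, Cycle 20 55918, Cycle 20 36462, Cycle 20 52846, Cycle 20 44654,
    Cycle 20 61038, Cycle 20 142, Cycle 20 206, Split 19 [Cycle 19 38071, Cycle 19 54455, Cycle 19 44215,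
    Cycle 19 60599, Cycle 19 143, Cycle 19 151, Cycle 19 215, Cycle 19 8] [48] (Split 20 [Cycle 20 37279,
    Cycle 20 53663, Cycle 20 39535, Cycle 20 55919, Cycle 20 36463, Cycle 20 52847, Cycle 20 44655, Cycle 20
    61039, Cycle 20 143, Cycle 20 207, Cycle 20 10] [53] (Split 48 [Cycle 48 8, Cycle 48 37278, Cycle 48
    53662, Cycle 48 39534, Cycle 48 55918, Cycle 48 36462, Cycle 48 52846, Cycle 48 44654, Cycle 48 61038,
    Cycle 48 142, Cycle 48 206, Cycle 48 10] [55,57] (Split 22 [Cycle 22 134, Cycle 22 198, Cycle 22 8, Cycle
    22 37278, Cycle 22 53662, Cycle 22 39534, Cycle 22 55918, Cycle 22 36462, Cycle 22 52846, Cycle 22 44654,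
    Cycle 22 61038, Cycle 22 142, Cycle 22 206, Split 17 [Cycle 17 38071, Cycle 17 54455, Cycle 17 44215,
    Cycle 17 60599, Cycle 17 143, Cycle 17 151, Cycle 17 215] [50] (Split 50 [Cycle 50 144, Cycle 50 208,
    Cycle 50 166, Cycle 50 37278, Cycle 50 53662, Cycle 50 39534, Cycle 50 55918, Cycle 50 36462, Cycle 50
    52846, Cycle 50 44654, Cycle 50 61038, Cycle 50 142, Cycle 50 206] [59,61] Overflow)] [59,61] Overflow))),
    Known 0 [(17,19),(19,17)]] [53,55] (Split 53 [Cycle 53 33598, Cycle 53 49982, Cycle 53 40318, Cycle 53
    56702, Cycle 53 39038, Cycle 53 134, Cycle 53 198, Cycle 53 10] [48,50] (Split 48 [Cycle 48 10, Cycle 48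
    37118, Cycle 48 53502, Cycle 48 39678, Cycle 48 56062, Cycle 48 36606, Cycle 48 52990, Cycle 48 44798,
    Cycle 48 61182, Cycle 48 34734, Cycle 48 51118, Cycle 48 158, Cycle 48 222] [57,59] (Split 50 [Cycle 50 8,
    Cycle 50 12, Cycle 50 10, Cycle 50 37118, Cycle 50 53502, Cycle 50 39678, Cycle 50 56062, Cycle 50 36606,
    Cycle 50 52990, Cycle 50 44798, Cycle 50 61182, Cycle 50 34734, Cycle 50 51118, Cycle 50 158, Cycle 50
    222] [61,63] Overflow)))))))))), Known 0 [(38,40),(40,38)], Known 1
    [(29,31),(31,29),(34,38),(36,40),(38,34),(40,36)], Known 2
    [(29,31),(31,29),(34,38),(36,40),(38,36),(40,34)], Cycle 33 8, Cycle 33 166, Cycle 33 230, Cycle 33 142,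
    Cycle 33 206, Cycle 33 158, Cycle 33 222] [42,44] (Split 17 [ Split 17 [Cycle 17 8, Cycle 17 140, Cycle 17
    204, Cycle 17 172, Cycle 17 236, Cycle 17 143, Cycle 17 175, Cycle 17 239, Cycle 17 151, Cycle 17 215,
    Cycle 17 40692, Cycle 17 57076] [46] (Split 20 [Cycle 20 142, Cycle 20 206, Cycle 20 41582] [35,37] (Split
    22 [Cycle 22 8, Cycle 22 12, Cycle 22 142, Cycle 22 206, Cycle 22 41582] [39,41] (Split 24 [Cycle 24 138,
    Cycle 24 202, Cycle 24 170, Cycle 24 234, Cycle 24 36386, Cycle 24 52770, Cycle 24 158] [43,45] (Split 26
    [Cycle 26 8, Cycle 26 12, Cycle 26 138, Cycle 26 202, Cycle 26 170, Cycle 26 234, Cycle 26 36386, Cycle 26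
    52770, Cycle 26 158] [47,49] (Split 28 [Cycle 28 35834, Cycle 28 52218, Cycle 28 44026, Cycle 28 60410,
    Cycle 28 34350, Cycle 28 50734, Cycle 28 42542, Cycle 28 58926, Cycle 28 134, Cycle 28 198, Cycle 28 150]
    [51,53] (Split 30 [Cycle 30 8, Cycle 30 12, Cycle 30 35834, Cycle 30 52218, Cycle 30 44026, Cycle 30
    60410, Cycle 30 34350, Cycle 30 50734, Cycle 30 42542, Cycle 30 58926, Cycle 30 134, Cycle 30 198, Cycle
    30 150] [55,57] (Split 32 [Cycle 32 38752, Cycle 32 55136, Cycle 32 46944, Cycle 32 63328, Cycle 32 34784,
    Cycle 32 51168, Cycle 32 42976, Cycle 32 59360, Cycle 32 34350, Cycle 32 50734, Cycle 32 42542, Cycle 32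
    58926, Cycle 32 134, Cycle 32 198, Cycle 32 150] [59,61] Overflow))))))), Known 0 [(42,44),(44,42)], Cycle
    17 36022, Cycle 17 52406, Cycle 17 44214, Cycle 17 60598, Cycle 17 142, Cycle 17 174, Cycle 17 238, Cycle
    17 150, Cycle 17 214, Split 17 [Cycle 17 37596, Cycle 17 53980, Cycle 17 36023, Cycle 17 52407, Cycle 17
    44215, Cycle 17 60599, Cycle 17 143, Cycle 17 175, Cycle 17 239, Cycle 17 151, Cycle 17 215, Cycle 17 8]
    [46] (Split 46 [Cycle 46 142, Cycle 46 206, Cycle 46 10] [35,37] (Split 32 [Cycle 32 33758, Cycle 32
    50142, Cycle 32 134, Cycle 32 198, Cycle 32 150] [39,41] (Split 22 [Cycle 22 39638, Cycle 22 56022, Cycle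
    22 8, Cycle 22 12, Cycle 22 143, Cycle 22 207, Cycle 22 10] [43] (Split 34 [Cycle 34 47022, Cycle 34 150,
    Cycle 34 214, Cycle 34 37854, Cycle 34 54238, Cycle 34 36670, Cycle 34 53054, Cycle 34 46046] [45,47]
    (Split 36 [Cycle 36 8, Cycle 36 12, Cycle 36 47022, Cycle 36 150, Cycle 36 214, Cycle 36 37854, Cycle 36
    54238, Cycle 36 36670, Cycle 36 53054, Cycle 36 46046] [49,51] (Split 35 [Cycle 35 37598, Cycle 35 53982,
    Cycle 35 36078, Cycle 35 52462, Cycle 35 40158, Cycle 35 56542, Cycle 35 36670, Cycle 35 53054, Cycle 35
    206] [48,50] (Split 37 [Cycle 37 8, Cycle 37 12, Cycle 37 37598, Cycle 37 53982, Cycle 37 36078, Cycle 37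
    52462, Cycle 37 40158, Cycle 37 56542, Cycle 37 36670, Cycle 37 53054, Cycle 37 206] [52,54] (Split 20
    [Cycle 20 38450, Cycle 20 54834, Cycle 20 46642, Cycle 20 63026, Cycle 20 8, Cycle 20 34236, Cycle 20
    50620, Cycle 20 142, Cycle 20 206, Split 19 [Cycle 19 136, Cycle 19 200, Cycle 19 168, Cycle 19 232, Cycle
    19 37757, Cycle 19 54141, Cycle 19 36023, Cycle 19 52407, Cycle 19 175, Cycle 19 239, Cycle 19 151, Cycle
    19 215] [56] (Split 20 [Cycle 20 38451, Cycle 20 54835, Cycle 20 46643, Cycle 20 63027, Cycle 20 9, Cycle
    20 34237, Cycle 20 50621, Cycle 20 143, Cycle 20 207] [53] (Split 53 [Cycle 53 8, Cycle 53 138, Cycle 53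
    202, Cycle 53 170, Cycle 53 234, Cycle 53 37598, Cycle 53 53982, Cycle 53 35942, Cycle 53 52326, Cycle 53
    40158, Cycle 53 56542, Cycle 53 134, Cycle 53 198] [58,60] Overflow))] [53,55] (Split 53 [Cycle 53 138,
    Cycle 53 202, Cycle 53 170, Cycle 53 234, Cycle 53 37598, Cycle 53 53982, Cycle 53 35942, Cycle 53 52326,
    Cycle 53 40158, Cycle 53 56542, Cycle 53 134, Cycle 53 198] [56,58] (Split 55 [Cycle 55 8, Cycle 55 12,
    Cycle 55 138, Cycle 55 202, Cycle 55 170, Cycle 55 234, Cycle 55 37598, Cycle 55 53982, Cycle 55 35942,
    Cycle 55 52326, Cycle 55 40158, Cycle 55 56542, Cycle 55 134, Cycle 55 198] [60,62] Overflow)))))))))),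
    Known 0 [(20,22),(22,20)]] [46,48] (Split 28 [Cycle 28 134, Cycle 28 198, Cycle 28 150] [35,37] (Split 30
    [Cycle 30 8, Cycle 30 12, Cycle 30 134, Cycle 30 198, Cycle 30 150] [39,41] (Split 46 [Cycle 46 36462,
    Cycle 46 52846, Cycle 46 44654, Cycle 46 61038, Cycle 46 142, Cycle 46 206, Cycle 46 10] [43,45] (Split 48
    [Cycle 48 8, Cycle 48 12, Cycle 48 36462, Cycle 48 52846, Cycle 48 44654, Cycle 48 61038, Cycle 48 142,
    Cycle 48 206, Cycle 48 10] [47,49] (Split 43 [Cycle 43 37598, Cycle 43 53982, Cycle 43 36078, Cycle 43
    52462, Cycle 43 44270, Cycle 43 60654, Cycle 43 46510, Cycle 43 36670, Cycle 43 53054, Cycle 43 142, Cycle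
    43 206] [50,52] (Split 45 [Cycle 45 8, Cycle 45 12, Cycle 45 37598, Cycle 45 53982, Cycle 45 36078, Cycle
    45 52462, Cycle 45 44270, Cycle 45 60654, Cycle 45 46510, Cycle 45 36670, Cycle 45 53054, Cycle 45 142,
    Cycle 45 206] [54,56] (Split 24 [Cycle 24 38370, Cycle 24 54754, Cycle 24 36606, Cycle 24 52990, Cycle 24
    44798, Cycle 24 61182, Split 24 [Cycle 24 38371, Cycle 24 54755, Cycle 24 36607, Cycle 24 52991, Cycle 24
    44799, Cycle 24 61183, Cycle 24 8, Cycle 24 159] [51] (Split 51 [Cycle 51 39902, Cycle 51 56286, Cycle 51
    48094, Cycle 51 64478, Cycle 51 37886, Cycle 51 54270, Cycle 51 36086, Cycle 51 52470, Cycle 51 44278,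
    Cycle 51 60662, Cycle 51 47080, Cycle 51 10, Cycle 51 150, Cycle 51 214] [58,60] Overflow), Known 0
    [(25,27),(27,25)], Cycle 24 158] [51,53] (Split 51 [Cycle 51 39902, Cycle 51 56286, Cycle 51 48094, Cycle
    51 64478, Cycle 51 37886, Cycle 51 54270, Cycle 51 36086, Cycle 51 52470, Cycle 51 44278, Cycle 51 60662,
    Split 35 [Cycle 35 39870, Cycle 35 56254, Cycle 35 48062, Cycle 35 64446, Cycle 35 150, Cycle 35 214,
    Cycle 35 33158, Cycle 35 49542, Cycle 35 41350, Cycle 35 57734, Cycle 35 46590, Cycle 35 38902, Cycle 35
    40694, Cycle 35 57078] [58,60] Overflow, Cycle 51 10, Cycle 51 150, Cycle 51 214] [58,60]
    Overflow))))))))))))))), Known 0 [(21,23),(23,21)], Cycle 16 158, Cycle 16 222] [29,31] (Split 18 [Cycle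
    18 8, Cycle 18 12, Cycle 18 150, Cycle 18 214, Split 18 [Cycle 18 9, Cycle 18 13, Cycle 18 151, Cycle 18
    215, Cycle 18 8, Cycle 18 159, Cycle 18 223] [33] (Split 21 [Cycle 21 142, Cycle 21 206, Cycle 21 158,
    Cycle 21 222] [28,30] (Split 23 [Cycle 23 9, Cycle 23 13, Cycle 23 143, Cycle 23 207, Cycle 23 159, Cycle
    23 223] [32] (Split 29 [Cycle 29 134, Cycle 29 166, Cycle 29 230, Cycle 29 142, Cycle 29 206, Cycle 29
    158, Cycle 29 222] [34,36] (Split 31 [Cycle 31 8, Cycle 31 12, Cycle 31 134, Cycle 31 166, Cycle 31 230,
    Cycle 31 142, Cycle 31 206, Cycle 31 158, Cycle 31 222] [38,40] (Split 33 [ Split 33 [Cycle 33 8, Split 28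
    [Cycle 28 134, Cycle 28 198, Cycle 28 150, Cycle 28 214] [35,37] (Split 30 [Cycle 30 8, Cycle 30 12, Cycle
    30 134, Cycle 30 198, Cycle 30 150, Cycle 30 214] [39,41] (Split 34 [Cycle 34 38904, Cycle 34 55288, Cycle
    34 47096, Cycle 34 63480, Cycle 34 36854, Cycle 34 53238, Cycle 34 40438, Cycle 34 56822] [43,45] (Split
    36 [Cycle 36 9, Cycle 36 13, Cycle 36 138, Cycle 36 202, Cycle 36 170, Cycle 36 234, Cycle 36 36855, Cycle
    36 53239, Cycle 36 40439, Cycle 36 56823] [47] (Split 38 [Cycle 38 134, Cycle 38 144, Cycle 38 208, Cycle
    38 38904, Cycle 38 55288, Cycle 38 47096, Cycle 38 63480, Cycle 38 36854, Cycle 38 53238, Cycle 38 40438,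
    Cycle 38 56822] [49,51] (Split 40 [Cycle 40 9, Cycle 40 13, Cycle 40 8, Cycle 40 182, Cycle 40 246, Cycle
    40 138, Cycle 40 202, Cycle 40 170, Cycle 40 234, Cycle 40 36855, Cycle 40 53239, Cycle 40 40439, Cycle 40
    56823] [53] (Split 43 [Cycle 43 174, Cycle 43 36590, Cycle 43 52974, Cycle 43 40174, Cycle 43 56558]
    [42,44] (Split 45 [Cycle 45 8, Cycle 45 12, Cycle 45 174, Cycle 45 36590, Cycle 45 52974, Cycle 45 40174,
    Cycle 45 56558] [46,48] (Split 49 [Cycle 49 150, Cycle 49 214, Cycle 49 182, Cycle 49 246, Cycle 49 174,
    Cycle 49 36590, Cycle 49 52974, Cycle 49 40174, Cycle 49 56558] [50,52] (Split 51 [Cycle 51 8, Cycle 51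
    12, Cycle 51 150, Cycle 51 214, Cycle 51 182, Cycle 51 246, Cycle 51 174, Cycle 51 36590, Cycle 51 52974,
    Cycle 51 40174, Cycle 51 56558] [54,56] (Split 35 [Cycle 35 35550, Cycle 35 51934, Cycle 35 43742, Cycle
    35 60126, Cycle 35 35422, Cycle 35 51806, Cycle 35 43614, Cycle 35 59998, Split 37 [Cycle 37 35550, Cycle
    37 51934, Cycle 37 43742, Cycle 37 60126, Cycle 37 35422, Cycle 37 51806, Cycle 37 43614, Cycle 37 59998,
    Cycle 37 8, Cycle 37 38902, Cycle 37 55286, Cycle 37 40694, Cycle 37 57078] [58,60] Overflow, Cycle 35
    38902, Cycle 35 55286, Cycle 35 40694, Cycle 35 57078] [58,60] Overflow)))))))))), Known 0
    [(34,36),(36,34)], Cycle 33 9, Cycle 33 167, Cycle 33 231, Cycle 33 143, Cycle 33 207, Cycle 33 159, Cycle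
    33 223] [42] (Split 40 [Cycle 40 36855, Cycle 40 53239, Cycle 40 40439, Cycle 40 56823] [35] (Split 28
    [Cycle 28 170, Cycle 28 134, Cycle 28 198, Cycle 28 150, Cycle 28 214] [37,39] (Split 30 [Cycle 30 8,
    Cycle 30 12, Cycle 30 170, Cycle 30 134, Cycle 30 198, Cycle 30 150, Cycle 30 214] [41,43] (Split 38
    [Cycle 38 38908, Cycle 38 55292, Cycle 38 47100, Cycle 38 63484, Cycle 38 8, Cycle 38 36854, Cycle 38
    53238, Cycle 38 40438, Cycle 38 56822] [45,47] (Split 42 [Cycle 42 166, Cycle 42 230, Cycle 42 138, Cycle
    42 202, Cycle 42 170, Cycle 42 234, Cycle 42 8, Cycle 42 38844, Cycle 42 55228, Cycle 42 40636, Cycle 42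
    57020] [49,51] (Split 35 [Cycle 35 172, Cycle 35 236, Cycle 35 174, Cycle 35 36590, Cycle 35 52974, Cycle
    35 40174, Cycle 35 56558] [44,46] (Split 20 [Cycle 20 37278, Cycle 20 53662, Cycle 20 39022, Cycle 20
    55406, Cycle 20 35950, Cycle 20 52334, Cycle 20 44142, Cycle 20 60526, Cycle 20 142, Cycle 20 206, Split
    19 [Cycle 19 38071, Cycle 19 54455, Cycle 19 44215, Cycle 19 60599, Cycle 19 143, Cycle 19 151, Cycle 19
    215, Cycle 19 8] [48] (Split 20 [Cycle 20 37279, Cycle 20 53663, Cycle 20 39023, Cycle 20 55407, Cycle 20
    35951, Cycle 20 52335, Cycle 20 44143, Cycle 20 60527, Cycle 20 143, Cycle 20 207, Cycle 20 10] [53]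
    (Split 48 [Cycle 48 8, Cycle 48 37278, Cycle 48 53662, Cycle 48 39022, Cycle 48 55406, Cycle 48 35950,
    Cycle 48 52334, Cycle 48 44142, Cycle 48 60526, Cycle 48 142, Cycle 48 206, Cycle 48 10] [55,57] (Split 22
    [Cycle 22 134, Cycle 22 198, Cycle 22 8, Cycle 22 37278, Cycle 22 53662, Cycle 22 39022, Cycle 22 55406,
    Cycle 22 35950, Cycle 22 52334, Cycle 22 44142, Cycle 22 60526, Cycle 22 142, Cycle 22 206, Split 17
    [Cycle 17 38071, Cycle 17 54455, Cycle 17 44215, Cycle 17 60599, Cycle 17 143, Cycle 17 151, Cycle 17 215]
    [50] (Split 50 [Cycle 50 144, Cycle 50 208, Cycle 50 166, Cycle 50 37278, Cycle 50 53662, Cycle 50 39022,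
    Cycle 50 55406, Cycle 50 35950, Cycle 50 52334, Cycle 50 44142, Cycle 50 60526, Cycle 50 142, Cycle 50
    206] [59,61] Overflow)] [59,61] Overflow))), Known 0 [(17,19),(19,17)]] [53,55] (Split 53 [Cycle 53 33598,
    Cycle 53 49982, Cycle 53 40062, Cycle 53 56446, Cycle 53 39294, Cycle 53 134, Cycle 53 198, Cycle 53 10]
    [48,50] (Split 48 [Cycle 48 10, Cycle 48 37630, Cycle 48 54014, Cycle 48 39166, Cycle 48 55550, Cycle 48
    36094, Cycle 48 52478, Cycle 48 44286, Cycle 48 60670, Cycle 48 34606, Cycle 48 50990, Cycle 48 158, Cycle
    48 222] [57,59] (Split 50 [Cycle 50 8, Cycle 50 12, Cycle 50 10, Cycle 50 37630, Cycle 50 54014, Cycle 50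
    39166, Cycle 50 55550, Cycle 50 36094, Cycle 50 52478, Cycle 50 44286, Cycle 50 60670, Cycle 50 34606,
    Cycle 50 50990, Cycle 50 158, Cycle 50 222] [61,63] Overflow)))))))))), Known 0 [(38,40),(40,38)], Known 1
    [(29,31),(31,29),(34,38),(36,40),(38,34),(40,36)], Known 2
    [(29,31),(31,29),(34,38),(36,40),(38,36),(40,34)], Cycle 33 8, Cycle 33 166, Cycle 33 230, Cycle 33 142,
    Cycle 33 206, Cycle 33 158, Cycle 33 222] [42,44] (Split 17 [ Split 17 [Cycle 17 8, Cycle 17 140, Cycle 17
    204, Cycle 17 172, Cycle 17 236, Cycle 17 143, Cycle 17 175, Cycle 17 239, Cycle 17 151, Cycle 17 215,
    Cycle 17 40692, Cycle 17 57076] [46] (Split 20 [Cycle 20 142, Cycle 20 206, Cycle 20 41070] [35,37] (Split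
    22 [Cycle 22 8, Cycle 22 12, Cycle 22 142, Cycle 22 206, Cycle 22 41070] [39,41] (Split 24 [Cycle 24 138,
    Cycle 24 202, Cycle 24 170, Cycle 24 234, Cycle 24 36354, Cycle 24 52738, Cycle 24 158] [43,45] (Split 26
    [Cycle 26 8, Cycle 26 12, Cycle 26 138, Cycle 26 202, Cycle 26 170, Cycle 26 234, Cycle 26 36354, Cycle 26
    52738, Cycle 26 158] [47,49] (Split 28 [Cycle 28 35834, Cycle 28 52218, Cycle 28 44026, Cycle 28 60410,
    Cycle 28 34318, Cycle 28 50702, Cycle 28 42510, Cycle 28 58894, Cycle 28 134, Cycle 28 198, Cycle 28 150]
    [51,53] (Split 30 [Cycle 30 8, Cycle 30 12, Cycle 30 35834, Cycle 30 52218, Cycle 30 44026, Cycle 30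
    60410, Cycle 30 34318, Cycle 30 50702, Cycle 30 42510, Cycle 30 58894, Cycle 30 134, Cycle 30 198, Cycle
    30 150] [55,57] (Split 32 [Cycle 32 38752, Cycle 32 55136, Cycle 32 46944, Cycle 32 63328, Cycle 32 34784,
    Cycle 32 51168, Cycle 32 42976, Cycle 32 59360, Cycle 32 34318, Cycle 32 50702, Cycle 32 42510, Cycle 32
    58894, Cycle 32 134, Cycle 32 198, Cycle 32 150] [59,61] Overflow))))))), Known 0 [(42,44),(44,42)], Cycle
    17 36022, Cycle 17 52406, Cycle 17 44214, Cycle 17 60598, Cycle 17 142, Cycle 17 174, Cycle 17 238, Cycle
    17 150, Cycle 17 214, Split 17 [Cycle 17 37596, Cycle 17 53980, Cycle 17 36023, Cycle 17 52407, Cycle 17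
    44215, Cycle 17 60599, Cycle 17 143, Cycle 17 175, Cycle 17 239, Cycle 17 151, Cycle 17 215, Cycle 17 8]
    [46] (Split 46 [Cycle 46 142, Cycle 46 206, Cycle 46 10] [35,37] (Split 32 [Cycle 32 33758, Cycle 32
    50142, Cycle 32 134, Cycle 32 198, Cycle 32 150] [39,41] (Split 22 [Cycle 22 37590, Cycle 22 53974, Cycle
    22 8, Cycle 22 12, Cycle 22 143, Cycle 22 207, Cycle 22 10] [43] (Split 34 [Cycle 34 47022, Cycle 34 150,
    Cycle 34 214, Cycle 34 37854, Cycle 34 54238, Cycle 34 36670, Cycle 34 53054, Cycle 34 46046] [45,47]
    (Split 36 [Cycle 36 8, Cycle 36 12, Cycle 36 47022, Cycle 36 150, Cycle 36 214, Cycle 36 37854, Cycle 36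
    54238, Cycle 36 36670, Cycle 36 53054, Cycle 36 46046] [49,51] (Split 35 [Cycle 35 37598, Cycle 35 53982,
    Cycle 35 36078, Cycle 35 52462, Cycle 35 39134, Cycle 35 55518, Cycle 35 36670, Cycle 35 53054, Cycle 35
    206] [48,50] (Split 37 [Cycle 37 8, Cycle 37 12, Cycle 37 37598, Cycle 37 53982, Cycle 37 36078, Cycle 37
    52462, Cycle 37 39134, Cycle 37 55518, Cycle 37 36670, Cycle 37 53054, Cycle 37 206] [52,54] (Split 20
    [Cycle 20 38450, Cycle 20 54834, Cycle 20 46642, Cycle 20 63026, Cycle 20 8, Cycle 20 34236, Cycle 20
    50620, Cycle 20 142, Cycle 20 206, Split 19 [Cycle 19 136, Cycle 19 200, Cycle 19 168, Cycle 19 232, Cycle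
    19 33661, Cycle 19 50045, Cycle 19 36023, Cycle 19 52407, Cycle 19 175, Cycle 19 239, Cycle 19 151, Cycle
    19 215] [56] (Split 20 [Cycle 20 38451, Cycle 20 54835, Cycle 20 46643, Cycle 20 63027, Cycle 20 9, Cycle
    20 34237, Cycle 20 50621, Cycle 20 143, Cycle 20 207] [53] (Split 53 [Cycle 53 8, Cycle 53 138, Cycle 53
    202, Cycle 53 170, Cycle 53 234, Cycle 53 37598, Cycle 53 53982, Cycle 53 35942, Cycle 53 52326, Cycle 53
    39134, Cycle 53 55518, Cycle 53 134, Cycle 53 198] [58,60] Overflow))] [53,55] (Split 53 [Cycle 53 138,
    Cycle 53 202, Cycle 53 170, Cycle 53 234, Cycle 53 37598, Cycle 53 53982, Cycle 53 35942, Cycle 53 52326,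
    Cycle 53 39134, Cycle 53 55518, Cycle 53 134, Cycle 53 198] [56,58] (Split 55 [Cycle 55 8, Cycle 55 12,
    Cycle 55 138, Cycle 55 202, Cycle 55 170, Cycle 55 234, Cycle 55 37598, Cycle 55 53982, Cycle 55 35942,
    Cycle 55 52326, Cycle 55 39134, Cycle 55 55518, Cycle 55 134, Cycle 55 198] [60,62] Overflow)))))))))),
    Known 0 [(20,22),(22,20)]] [46,48] (Split 28 [Cycle 28 134, Cycle 28 198, Cycle 28 150] [35,37] (Split 30
    [Cycle 30 8, Cycle 30 12, Cycle 30 134, Cycle 30 198, Cycle 30 150] [39,41] (Split 46 [Cycle 46 35950,
    Cycle 46 52334, Cycle 46 44142, Cycle 46 60526, Cycle 46 142, Cycle 46 206, Cycle 46 10] [43,45] (Split 48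
    [Cycle 48 8, Cycle 48 12, Cycle 48 35950, Cycle 48 52334, Cycle 48 44142, Cycle 48 60526, Cycle 48 142,
    Cycle 48 206, Cycle 48 10] [47,49] (Split 43 [Cycle 43 37598, Cycle 43 53982, Cycle 43 36078, Cycle 43
    52462, Cycle 43 44270, Cycle 43 60654, Cycle 43 42414, Cycle 43 36670, Cycle 43 53054, Cycle 43 142, Cycle
    43 206] [50,52] (Split 45 [Cycle 45 8, Cycle 45 12, Cycle 45 37598, Cycle 45 53982, Cycle 45 36078, Cycle
    45 52462, Cycle 45 44270, Cycle 45 60654, Cycle 45 42414, Cycle 45 36670, Cycle 45 53054, Cycle 45 142,
    Cycle 45 206] [54,56] (Split 24 [Cycle 24 38338, Cycle 24 54722, Cycle 24 36094, Cycle 24 52478, Cycle 24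
    44286, Cycle 24 60670, Split 24 [Cycle 24 38339, Cycle 24 54723, Cycle 24 36095, Cycle 24 52479, Cycle 24
    44287, Cycle 24 60671, Cycle 24 8, Cycle 24 159] [51] (Split 51 [Cycle 51 39902, Cycle 51 56286, Cycle 51
    48094, Cycle 51 64478, Cycle 51 37886, Cycle 51 54270, Cycle 51 36086, Cycle 51 52470, Cycle 51 44278,
    Cycle 51 60662, Cycle 51 42984, Cycle 51 10, Cycle 51 150, Cycle 51 214] [58,60] Overflow), Known 0
    [(25,27),(27,25)], Cycle 24 158] [51,53] (Split 51 [Cycle 51 39902, Cycle 51 56286, Cycle 51 48094, Cycle
    51 64478, Cycle 51 37886, Cycle 51 54270, Cycle 51 36086, Cycle 51 52470, Cycle 51 44278, Cycle 51 60662,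
    Split 35 [Cycle 35 39870, Cycle 35 56254, Cycle 35 48062, Cycle 35 64446, Cycle 35 150, Cycle 35 214,
    Cycle 35 37254, Cycle 35 53638, Cycle 35 45446, Cycle 35 61830, Cycle 35 46590, Cycle 35 38902, Cycle 35
    40694, Cycle 35 57078] [58,60] Overflow, Cycle 51 10, Cycle 51 150, Cycle 51 214] [58,60]
    Overflow)))))))))))))), Known 0 [(21,23),(23,21)], Cycle 18 158, Cycle 18 222] [33,35] (Split 21 [Cycle 21
    142, Cycle 21 206, Cycle 21 158, Cycle 21 222] [28,30] (Split 23 [Cycle 23 8, Cycle 23 12, Cycle 23 142,
    Cycle 23 206, Cycle 23 158, Cycle 23 222] [32,34] (Split 29 [Cycle 29 134, Cycle 29 198, Cycle 29 166,
    Cycle 29 230, Cycle 29 142, Cycle 29 206, Cycle 29 158, Cycle 29 222] [36,38] (Split 31 [Cycle 31 8, Cycle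
    31 12, Cycle 31 134, Cycle 31 198, Cycle 31 166, Cycle 31 230, Cycle 31 142, Cycle 31 206, Cycle 31 158,
    Cycle 31 222] [40,42] (Split 28 [Cycle 28 142, Cycle 28 206, Cycle 28 134, Cycle 28 198, Cycle 28 150,
    Cycle 28 214] [37,39] (Split 30 [Cycle 30 8, Cycle 30 12, Cycle 30 142, Cycle 30 206, Cycle 30 134, Cycle
    30 198, Cycle 30 150, Cycle 30 214] [41,43] (Split 33 [ Split 33 [Cycle 33 8, Split 35 [Cycle 35 12, Cycle
    35 208, Cycle 35 8, Cycle 35 212, Cycle 35 134, Cycle 35 198, Cycle 35 142, Cycle 35 206, Cycle 35 158,
    Cycle 35 222] [44,46] (Split 36 [Cycle 36 38904, Cycle 36 55288, Cycle 36 47096, Cycle 36 63480, Cycle 36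
    36834, Cycle 36 53218, Cycle 36 40418, Cycle 36 56802] [45,47] (Split 38 [Cycle 38 9, Cycle 38 13, Cycle
    38 38904, Cycle 38 55288, Cycle 38 47096, Cycle 38 63480, Cycle 38 36835, Cycle 38 53219, Cycle 38 40419,
    Cycle 38 56803] [49] (Split 40 [Cycle 40 150, Cycle 40 144, Cycle 40 208, Cycle 40 38904, Cycle 40 55288,
    Cycle 40 47096, Cycle 40 63480, Cycle 40 36850, Cycle 40 53234, Cycle 40 40434, Cycle 40 56818] [51,53]
    (Split 42 [Cycle 42 9, Cycle 42 13, Cycle 42 8, Cycle 42 182, Cycle 42 246, Cycle 42 38908, Cycle 42
    55292, Cycle 42 47100, Cycle 42 63484, Cycle 42 36851, Cycle 42 53235, Cycle 42 40435, Cycle 42 56819]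
    [55] (Split 45 [Cycle 45 142, Cycle 45 206, Cycle 45 36858, Cycle 45 53242, Cycle 45 38374, Cycle 45
    54758, Cycle 45 40422, Cycle 45 56806] [48,50] (Split 47 [Cycle 47 8, Cycle 47 12, Cycle 47 142, Cycle 47
    206, Cycle 47 36858, Cycle 47 53242, Cycle 47 38374, Cycle 47 54758, Cycle 47 40422, Cycle 47 56806]
    [52,54] (Split 51 [Cycle 51 150, Cycle 51 214, Cycle 51 182, Cycle 51 246, Cycle 51 142, Cycle 51 206,
    Cycle 51 36858, Cycle 51 53242, Cycle 51 38374, Cycle 51 54758, Cycle 51 40422, Cycle 51 56806] [56,58]
    (Split 53 [Cycle 53 8, Cycle 53 12, Cycle 53 150, Cycle 53 214, Cycle 53 182, Cycle 53 246, Cycle 53 142,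
    Cycle 53 206, Cycle 53 36858, Cycle 53 53242, Cycle 53 38374, Cycle 53 54758, Cycle 53 40422, Cycle 53
    56806] [60,62] Overflow)))))))), Known 0 [(36,38),(38,36)], Cycle 33 135, Cycle 33 199, Cycle 33 143,
    Cycle 33 207, Cycle 33 159, Cycle 33 223] [44] (Split 19 [Cycle 19 34154, Split 17 [Cycle 17 42346, Cycle
    17 47466, Cycle 17 152, Cycle 17 216, Cycle 17 142, Cycle 17 206, Cycle 17 150, Cycle 17 214, Cycle 17
    40696, Cycle 17 57080] [46,48] (Split 25 [Cycle 25 174, Cycle 25 238, Cycle 25 42490, Cycle 25 47610,
    Cycle 25 40574, Cycle 25 56958, Cycle 25 134, Cycle 25 198, Cycle 25 36750, Cycle 25 53134, Cycle 25 158,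
    Cycle 25 222] [50,52] (Split 27 [Cycle 27 8, Cycle 27 12, Cycle 27 174, Cycle 27 238, Cycle 27 42490,
    Cycle 27 47610, Cycle 27 40574, Cycle 27 56958, Cycle 27 134, Cycle 27 198, Cycle 27 36750, Cycle 27
    53134, Cycle 27 158, Cycle 27 222] [54,56] (Split 35 [Cycle 35 35458, Cycle 35 51842, Cycle 35 43650,
    Cycle 35 60034, Cycle 35 132, Cycle 35 196, Cycle 35 8, Cycle 35 41942, Cycle 35 156, Cycle 35 220, Cycle
    35 134, Cycle 35 198, Cycle 35 142, Cycle 35 206, Cycle 35 158, Cycle 35 222] [58,60] Overflow))), Cycle
    19 39274, Cycle 19 38454, Cycle 19 54838, Cycle 19 142, Cycle 19 206, Cycle 19 150, Cycle 19 214, Split 44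
    [Cycle 44 38904, Cycle 44 55288, Cycle 44 47096, Cycle 44 63480, Cycle 44 10, Cycle 44 35902, Cycle 44
    52286, Cycle 44 36728, Cycle 44 33758] [45,47] (Split 45 [Cycle 45 10, Cycle 45 206, Cycle 45 174, Cycle
    45 238, Cycle 45 36850, Cycle 45 53234, Cycle 45 38898, Cycle 45 55282, Cycle 45 36702, Cycle 45 33726]
    [46,48] (Split 47 [Cycle 47 8, Cycle 47 12, Cycle 47 10, Cycle 47 206, Cycle 47 174, Cycle 47 238, Cycle
    47 36850, Cycle 47 53234, Cycle 47 38898, Cycle 47 55282, Cycle 47 36702, Cycle 47 33726] [50,52] (Split
    17 [Cycle 17 33078, Cycle 17 49462, Cycle 17 41270, Cycle 17 57654, Cycle 17 37744, Cycle 17 39274, Cycle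
    17 38454, Cycle 17 54838, Cycle 17 142, Cycle 17 206, Cycle 17 150, Cycle 17 214, Cycle 17 8, Split 17
    [Cycle 17 33079, Cycle 17 49463, Cycle 17 41271, Cycle 17 57655, Cycle 17 37745, Cycle 17 39275, Cycle 17
    38455, Cycle 17 54839, Cycle 17 143, Cycle 17 207, Cycle 17 151, Cycle 17 215, Cycle 17 9] [54] (Split 19
    [Cycle 19 9, Cycle 19 33079, Cycle 19 49463, Cycle 19 41271, Cycle 19 57655, Cycle 19 37749, Cycle 19
    39275, Cycle 19 38455, Cycle 19 54839, Cycle 19 143, Cycle 19 207, Cycle 19 151, Cycle 19 215, Cycle 19
    13] [56] (Split 20 [Cycle 20 38329, Cycle 20 54713, Cycle 20 46521, Cycle 20 62905, Cycle 20 139, Cycle 20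
    143, Cycle 20 207] [49] (Split 49 [Cycle 49 142, Cycle 49 8, Cycle 49 33150, Cycle 49 49534, Cycle 49
    41342, Cycle 49 57726, Cycle 49 37746, Cycle 49 39134, Cycle 49 38526, Cycle 49 54910, Cycle 49 35698,
    Cycle 49 52082, Cycle 49 134, Cycle 49 198, Cycle 49 10] [58,60] Overflow)))] [54,56] (Split 20 [Cycle 20
    38320, Cycle 20 54704, Cycle 20 46512, Cycle 20 62896, Cycle 20 138, Cycle 20 142, Cycle 20 206, Cycle 20
    8] [49,51] (Split 49 [Cycle 49 174, Cycle 49 238, Cycle 49 33150, Cycle 49 49534, Cycle 49 41342, Cycle 49
    57726, Cycle 49 37730, Cycle 49 39134, Cycle 49 38526, Cycle 49 54910, Cycle 49 35682, Cycle 49 52066,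
    Cycle 49 134, Cycle 49 198, Cycle 49 10] [58,60] Overflow))))), Known 0 [(20,22),(22,20)]] [46,48] (Split
    25 [Cycle 25 142, Cycle 25 206, Cycle 25 34298, Split 17 [Cycle 17 8, Cycle 17 12, Cycle 17 42346, Cycle
    17 47466, Cycle 17 39614, Cycle 17 55998, Cycle 17 142, Cycle 17 206, Cycle 17 150, Cycle 17 214, Cycle 17
    40870, Cycle 17 57254] [50,52] (Split 27 [Cycle 27 174, Cycle 27 238, Cycle 27 142, Cycle 27 206, Cycle 27
    42490, Cycle 27 47610, Cycle 27 152, Cycle 27 216, Cycle 27 134, Cycle 27 198, Cycle 27 38904, Cycle 27
    55288, Cycle 27 158, Cycle 27 222] [54,56] (Split 35 [Cycle 35 132, Cycle 35 196, Cycle 35 44674, Cycle 35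
    61058, Cycle 35 36482, Cycle 35 52866, Cycle 35 8, Cycle 35 43766, Cycle 35 156, Cycle 35 220, Cycle 35
    134, Cycle 35 198, Cycle 35 142, Cycle 35 206, Cycle 35 158, Cycle 35 222] [58,60] Overflow)), Cycle 25
    39418, Cycle 25 38526, Cycle 25 54910, Cycle 25 134, Cycle 25 198, Split 44 [Cycle 44 38904, Cycle 44
    55288, Cycle 44 47096, Cycle 44 63480, Cycle 44 10, Cycle 44 33534, Cycle 44 35832, Cycle 44 56350]
    [45,47] (Split 45 [Cycle 45 36702, Cycle 45 53086, Cycle 45 10, Cycle 45 206, Cycle 45 174, Cycle 45 238,
    Cycle 45 36850, Cycle 45 53234, Cycle 45 43998, Cycle 45 35326, Cycle 45 40690, Cycle 45 57074] [50,52]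
    (Split 47 [Cycle 47 8, Cycle 47 12, Cycle 47 36702, Cycle 47 53086, Cycle 47 10, Cycle 47 206, Cycle 47
    174, Cycle 47 238, Cycle 47 36850, Cycle 47 53234, Cycle 47 43998, Cycle 47 35326, Cycle 47 40690, Cycle
    47 57074] [54,56] (Split 27 [Cycle 27 33150, Cycle 27 49534, Cycle 27 41342, Cycle 27 57726, Cycle 27 142,
    Cycle 27 206, Cycle 27 38896, Cycle 27 39418, Cycle 27 38526, Cycle 27 54910, Cycle 27 134, Cycle 27 198,
    Cycle 27 8, Split 24 [Cycle 24 38897, Cycle 24 55281, Cycle 24 47089, Cycle 24 63473, Cycle 24 131, Cycle
    24 9, Cycle 24 223] [49] (Split 49 [Cycle 49 35326, Cycle 49 51710, Cycle 49 43518, Cycle 49 59902, Cycle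
    49 36706, Cycle 49 53090, Cycle 49 38882, Cycle 49 39422, Cycle 49 38494, Cycle 49 54878, Cycle 49 36834,
    Cycle 49 53218, Cycle 49 10, Cycle 49 150, Cycle 49 214] [58,60] Overflow), Cycle 27 158, Cycle 27 222]
    [58,60] Overflow))), Known 0 [(24,26),(26,24)], Cycle 25 158, Cycle 25 222] [50,52] (Split 44 [Cycle 44
    38904, Cycle 44 55288, Cycle 44 47096, Cycle 44 63480, Cycle 44 10, Cycle 44 38840, Cycle 44 57016]
    [45,47] (Split 45 [Cycle 45 43998, Cycle 45 60382, Cycle 45 36702, Cycle 45 53086, Cycle 45 10, Cycle 45
    206, Cycle 45 174, Cycle 45 238, Cycle 45 36850, Cycle 45 53234, Cycle 45 38898, Cycle 45 55282, Cycle 45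
    40690, Cycle 45 57074] [54,56] (Split 47 [Cycle 47 8, Cycle 47 12, Cycle 47 43998, Cycle 47 60382, Cycle
    47 36702, Cycle 47 53086, Cycle 47 10, Cycle 47 206, Cycle 47 174, Cycle 47 238, Cycle 47 36850, Cycle 47
    53234, Cycle 47 38898, Cycle 47 55282, Cycle 47 40690, Cycle 47 57074] [58,60] Overflow))))), Known 0
    [(40,42),(42,40)], Known 1 [(29,31),(31,29),(36,40),(38,42),(40,36),(42,38)], Known 2
    [(29,31),(31,29),(36,40),(38,42),(40,38),(42,36)], Cycle 33 134, Cycle 33 198, Cycle 33 142, Cycle 33 206,
    Cycle 33 158, Cycle 33 222] [44,46] (Split 35 [Cycle 35 8, Cycle 35 12, Split 40 [Cycle 40 38896, Cycle 40
    55280, Cycle 40 47088, Cycle 40 63472, Cycle 40 8, Cycle 40 38832, Cycle 40 55216, Cycle 40 40624, Cycle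
    40 57008] [45,47] (Split 45 [Cycle 45 174, Cycle 45 238, Cycle 45 10, Split 45 [Cycle 45 175, Cycle 45
    239, Cycle 45 11, Cycle 45 8, Cycle 45 36835, Cycle 45 53219, Cycle 45 38883, Cycle 45 55267, Cycle 45
    40675, Cycle 45 57059] [48] (Split 35 [Cycle 35 139, Cycle 35 9, Cycle 35 13, Cycle 35 243, Cycle 35 152,
    Cycle 35 135, Cycle 35 199, Cycle 35 143, Cycle 35 207, Cycle 35 159, Cycle 35 223] [50] (Split 38 [Cycle
    38 10, Cycle 38 38910, Cycle 38 55294, Cycle 38 47102, Cycle 38 63486, Cycle 38 36835, Cycle 38 53219,
    Cycle 38 40419, Cycle 38 56803] [49] (Split 48 [Cycle 48 8, Cycle 48 10, Cycle 48 38910, Cycle 48 55294,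
    Cycle 48 47102, Cycle 48 63486, Cycle 48 38846, Cycle 48 55230, Cycle 48 40638, Cycle 48 57022] [51,53]
    (Split 50 [Cycle 50 144, Cycle 50 208, Cycle 50 150, Cycle 50 166, Cycle 50 38904, Cycle 50 55288, Cycle
    50 47096, Cycle 50 63480, Cycle 50 38840, Cycle 50 55224, Cycle 50 40632, Cycle 50 57016] [55,57] (Split
    36 [Cycle 36 134, Cycle 36 198, Cycle 36 154, Cycle 36 218, Cycle 36 8, Split 47 [Cycle 47 175, Cycle 47
    239, Cycle 47 11, Cycle 47 36851, Cycle 47 53235, Cycle 47 38899, Cycle 47 55283, Cycle 47 40691, Cycle 47
    57075] [52] (Split 52 [Cycle 52 134, Cycle 52 198, Cycle 52 144, Cycle 52 208, Cycle 52 142, Cycle 52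
    38910, Cycle 52 55294, Cycle 52 47102, Cycle 52 63486, Cycle 52 38846, Cycle 52 55230, Cycle 52 40638,
    Cycle 52 57022] [59,61] Overflow), Cycle 36 37788, Cycle 36 54172, Cycle 36 45980, Cycle 36 62364, Cycle
    36 36834, Cycle 36 53218, Cycle 36 40418, Cycle 36 56802] [59,61] Overflow))))), Known 0
    [(36,38),(38,36)], Cycle 45 36834, Cycle 45 53218, Cycle 45 38882, Cycle 45 55266, Cycle 45 40674, Cycle
    45 57058] [48,50] (Split 48 [Cycle 48 10, Cycle 48 38910, Cycle 48 55294, Cycle 48 47102, Cycle 48 63486,
    Cycle 48 158, Cycle 48 38846, Cycle 48 55230, Cycle 48 40638, Cycle 48 57022] [49,51] (Split 50 [Cycle 50
    8, Cycle 50 12, Cycle 50 10, Cycle 50 38910, Cycle 50 55294, Cycle 50 47102, Cycle 50 63486, Cycle 50 158,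
    Cycle 50 38846, Cycle 50 55230, Cycle 50 40638, Cycle 50 57022] [53,55] (Split 35 [Cycle 35 9, Cycle 35
    13, Split 38 [Cycle 38 155, Cycle 38 219, Cycle 38 187, Cycle 38 251, Cycle 38 166, Cycle 38 38904, Cycle
    38 55288, Cycle 38 47096, Cycle 38 63480, Cycle 38 36835, Cycle 38 53219, Cycle 38 40419, Cycle 38 56803]
    [57] (Split 36 [Cycle 36 8, Cycle 36 154, Cycle 36 218, Cycle 36 186, Cycle 36 250, Cycle 36 132, Cycle 36
    38908, Cycle 36 55292, Cycle 36 47100, Cycle 36 63484, Cycle 36 36834, Cycle 36 53218, Cycle 36 40418,
    Cycle 36 56802] [59,61] Overflow), Known 0 [(36,38),(38,36)], Cycle 35 135, Cycle 35 199, Cycle 35 143,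
    Cycle 35 207, Cycle 35 159, Cycle 35 223] [52] (Split 32 [Cycle 32 39670, Cycle 32 56054, Cycle 32 47862,
    Cycle 32 64246, Cycle 32 35062, Split 52 [Cycle 52 144, Cycle 52 208, Cycle 52 176, Cycle 52 240, Cycle 52
    166, Cycle 52 38904, Cycle 52 35326, Cycle 52 47096, Cycle 52 63480, Cycle 52 38840, Cycle 52 55224, Cycle
    52 40632, Cycle 52 57016] [57,59] (Split 34 [Cycle 34 33526, Cycle 34 49910, Cycle 34 39670, Cycle 34
    56054, Cycle 34 47862, Cycle 34 64246, Cycle 34 35062, Cycle 34 8, Split 32 [Cycle 32 33527, Cycle 32
    49911, Cycle 32 39671, Cycle 32 56055, Cycle 32 47863, Cycle 32 64247, Cycle 32 35063, Cycle 32 9, Cycle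
    32 145, Cycle 32 209, Cycle 32 135, Cycle 32 199, Cycle 32 151, Cycle 32 215] [61] Overflow, Cycle 34 144,
    Cycle 34 208, Cycle 34 134, Cycle 34 198, Cycle 34 150, Cycle 34 214] [61,63] Overflow), Known 0
    [(41,43),(43,41)], Known 1 [(28,30),(30,28),(37,41),(39,43),(41,37),(43,39)], Known 2
    [(28,30),(30,28),(37,41),(39,43),(41,39),(43,37)], Cycle 32 134, Cycle 32 198, Cycle 32 150, Cycle 32 214]
    [57,59] (Split 52 [Cycle 52 43000, Cycle 52 59384, Cycle 52 144, Cycle 52 208, Cycle 52 176, Cycle 52 240,
    Cycle 52 166, Cycle 52 38904, Cycle 52 55288, Cycle 52 47096, Cycle 52 63480, Cycle 52 38840, Cycle 52
    55224, Cycle 52 40632, Cycle 52 57016] [61,63] Overflow)))))), Known 0 [(40,42),(42,40)], Known 1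
    [(29,31),(31,29),(36,40),(38,42),(40,36),(42,38)], Known 2
    [(29,31),(31,29),(36,40),(38,42),(40,38),(42,36)], Cycle 35 134, Cycle 35 198, Cycle 35 142, Cycle 35 206,
    Cycle 35 158, Cycle 35 222] [48,50] (Split 25 [ Split 44 [Cycle 44 38210, Cycle 44 54594, Cycle 44 46402,
    Cycle 44 62786, Cycle 44 130, Split 44 [Cycle 44 38243, Cycle 44 54627, Cycle 44 46435, Cycle 44 62819,
    Cycle 44 10, Cycle 44 158, Cycle 44 222] [45] (Split 17 [Cycle 17 230, Cycle 17 55998, Cycle 17 38590,
    Cycle 17 36266, Cycle 17 52650, Cycle 17 44458, Cycle 17 60842, Cycle 17 142, Cycle 17 206, Cycle 17 150,
    Cycle 17 214, Cycle 17 40806, Cycle 17 57190] [52,54] (Split 19 [Cycle 19 8, Cycle 19 12, Cycle 19 230,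
    Cycle 19 55998, Cycle 19 38590, Cycle 19 36266, Cycle 19 52650, Cycle 19 44458, Cycle 19 60842, Cycle 19
    142, Cycle 19 206, Cycle 19 150, Cycle 19 214, Cycle 19 40806, Cycle 19 57190] [56,58] (Split 45 [Cycle 45
    36702, Cycle 45 53086, Cycle 45 44894, Cycle 45 61278, Cycle 45 8, Cycle 45 39422, Cycle 45 10, Cycle 45
    142, Cycle 45 206, Cycle 45 174, Cycle 45 238, Cycle 45 35526, Cycle 45 51910, Cycle 45 140, Cycle 45 204,
    Cycle 45 40390, Cycle 45 56774] [60,62] Overflow))), Cycle 44 40642, Cycle 44 57026] [45,47] (Split 45
    [Cycle 45 43998, Cycle 45 35326, Cycle 45 10, Cycle 45 142, Cycle 45 206, Cycle 45 174, Cycle 45 238,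
    Cycle 45 35462, Cycle 45 51846, Cycle 45 36742, Cycle 45 53126, Cycle 45 40326, Cycle 45 56710] [52,54]
    (Split 47 [Cycle 47 8, Cycle 47 12, Cycle 47 43998, Cycle 47 35326, Cycle 47 10, Cycle 47 142, Cycle 47
    206, Cycle 47 174, Cycle 47 238, Cycle 47 35462, Cycle 47 51846, Cycle 47 36742, Cycle 47 53126, Cycle 47
    40326, Cycle 47 56710] [56,58] (Split 17 [Cycle 17 39274, Cycle 17 55658, Cycle 17 47466, Cycle 17 63850,
    Cycle 17 166, Split 17 [Cycle 17 148, Cycle 17 212, Cycle 17 180, Cycle 17 244, Cycle 17 8, Cycle 17
    37567, Cycle 17 140, Cycle 17 204, Cycle 17 172, Cycle 17 236, Cycle 17 143, Cycle 17 207, Cycle 17 151,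
    Cycle 17 215, Cycle 17 40743, Cycle 17 57127] [60] Overflow, Cycle 17 37566, Cycle 17 36010, Cycle 17
    52394, Cycle 17 44202, Cycle 17 60586, Cycle 17 142, Cycle 17 206, Cycle 17 150, Cycle 17 214, Cycle 17
    40742, Cycle 17 57126] [60,62] Overflow))), Known 0 [(48,50),(50,48)], Known 1
    [(33,35),(35,33),(44,48),(46,50),(48,44),(50,46)], Known 2
    [(33,35),(35,33),(44,48),(46,50),(48,46),(50,44)], Known 3
    [(16,18),(18,16),(29,33),(31,35),(33,29),(35,31),(36,44),(38,46),(40,48),(42,50),(44,36),(46,38),(48,40),(50,42)],
    Known 4
    [(16,18),(18,16),(29,33),(31,35),(33,29),(35,31),(36,44),(38,46),(40,48),(42,50),(44,36),(46,38),(48,42),(50,40)],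
    Known 5
    [(16,18),(18,16),(29,33),(31,35),(33,31),(35,29),(36,44),(38,46),(40,48),(42,50),(44,40),(46,42),(48,36),(50,38)],
    Known 6
    [(16,18),(18,16),(29,33),(31,35),(33,31),(35,29),(36,44),(38,46),(40,48),(42,50),(44,40),(46,42),(48,38),(50,36)],
    Cycle 25 134, Cycle 25 198, Split 24 [Cycle 24 38896, Cycle 24 55280, Cycle 24 47088, Cycle 24 63472,
    Split 24 [Cycle 24 38897, Cycle 24 55281, Cycle 24 47089, Cycle 24 63473, Cycle 24 9, Cycle 24 159, Cycle
    24 223] [45] (Split 45 [Cycle 45 34786, Cycle 45 51170, Cycle 45 42978, Cycle 45 59362, Cycle 45 38882,
    Cycle 45 55266, Cycle 45 47074, Cycle 45 63458, Cycle 45 36834, Cycle 45 53218, Cycle 45 10, Cycle 45 150,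
    Cycle 45 214] [52,54] (Split 26 [Cycle 26 38901, Cycle 26 55285, Cycle 26 47093, Cycle 26 63477, Cycle 26
    13, Cycle 26 159, Cycle 26 223] [47] (Split 25 [Cycle 25 147, Cycle 25 211, Cycle 25 34809, Cycle 25
    51193, Cycle 25 43001, Cycle 25 59385, Cycle 25 38905, Cycle 25 55289, Cycle 25 47097, Cycle 25 63481,
    Cycle 25 135, Cycle 25 199, Cycle 25 159, Cycle 25 223] [56] (Split 47 [Cycle 47 8, Cycle 47 132, Cycle 47
    196, Cycle 47 34794, Cycle 47 51178, Cycle 47 42986, Cycle 47 59370, Cycle 47 38890, Cycle 47 55274, Cycle
    47 47082, Cycle 47 63466, Cycle 47 36842, Cycle 47 53226, Cycle 47 150, Cycle 47 214] [58,60]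
    Overflow)))), Cycle 24 8, Cycle 24 158, Cycle 24 222] [45,47] (Split 27 [Cycle 27 34800, Cycle 27 51184,
    Cycle 27 42992, Cycle 27 59376, Cycle 27 38896, Cycle 27 55280, Cycle 27 47088, Cycle 27 63472, Cycle 27
    134, Cycle 27 198, Cycle 27 8, Cycle 27 158, Cycle 27 222] [52,54] (Split 45 [Cycle 45 142, Cycle 45 206,
    Cycle 45 34786, Cycle 45 51170, Cycle 45 42978, Cycle 45 59362, Cycle 45 38882, Cycle 45 55266, Cycle 45
    47074, Cycle 45 63458, Cycle 45 36834, Cycle 45 53218, Cycle 45 10, Cycle 45 150, Cycle 45 214] [56,58]
    (Split 47 [Cycle 47 8, Cycle 47 12, Cycle 47 142, Cycle 47 206, Cycle 47 34786, Cycle 47 51170, Cycle 47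
    42978, Cycle 47 59362, Cycle 47 38882, Cycle 47 55266, Cycle 47 47074, Cycle 47 63458, Cycle 47 36834,
    Cycle 47 53218, Cycle 47 10, Cycle 47 150, Cycle 47 214] [60,62] Overflow))), Known 0 [(24,26),(26,24)],
    Cycle 25 158, Cycle 25 222] [52,54] (Split 27 [Cycle 27 8, Cycle 27 12, Split 48 [Cycle 48 38896, Cycle 48
    55280, Cycle 48 47088, Cycle 48 63472, Cycle 48 8, Split 19 [Cycle 19 167, Cycle 19 231, Cycle 19 8, Cycle
    19 37055, Cycle 19 53439, Cycle 19 140, Cycle 19 204, Cycle 19 172, Cycle 19 236, Cycle 19 143, Cycle 19
    207, Cycle 19 151, Cycle 19 215, Cycle 19 40711, Cycle 19 57095] [56] (Split 17 [Cycle 17 8, Cycle 17 166,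
    Cycle 17 230, Cycle 17 134, Cycle 17 12, Cycle 17 148, Cycle 17 212, Cycle 17 35882, Cycle 17 52266, Cycle
    17 44074, Cycle 17 60458, Cycle 17 142, Cycle 17 206, Cycle 17 150, Cycle 17 214, Cycle 17 40710, Cycle 17
    57094] [58,60] Overflow), Known 0 [(17,19),(19,17)]] [45,47] (Split 17 [Cycle 17 166, Cycle 17 230, Cycle
    17 134, Cycle 17 37054, Cycle 17 53438, Cycle 17 35882, Cycle 17 52266, Cycle 17 44074, Cycle 17 60458,
    Cycle 17 142, Cycle 17 206, Cycle 17 150, Cycle 17 214, Cycle 17 40710, Cycle 17 57094] [56,58] (Split 19
    [Cycle 19 8, Cycle 19 12, Cycle 19 166, Cycle 19 230, Cycle 19 134, Cycle 19 37054, Cycle 19 53438, Cycle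
    19 35882, Cycle 19 52266, Cycle 19 44074, Cycle 19 60458, Cycle 19 142, Cycle 19 206, Cycle 19 150, Cycle
    19 214, Cycle 19 40710, Cycle 19 57094] [60,62] Overflow)), Known 0 [(48,50),(50,48)], Known 1
    [(33,35),(35,33),(44,48),(46,50),(48,44),(50,46)], Known 2
    [(33,35),(35,33),(44,48),(46,50),(48,46),(50,44)], Known 3
    [(16,18),(18,16),(29,33),(31,35),(33,29),(35,31),(36,44),(38,46),(40,48),(42,50),(44,36),(46,38),(48,40),(50,42)],
    Known 4
    [(16,18),(18,16),(29,33),(31,35),(33,29),(35,31),(36,44),(38,46),(40,48),(42,50),(44,36),(46,38),(48,42),(50,40)],
    Known 5
    [(16,18),(18,16),(29,33),(31,35),(33,31),(35,29),(36,44),(38,46),(40,48),(42,50),(44,40),(46,42),(48,36),(50,38)],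
    Known 6
    [(16,18),(18,16),(29,33),(31,35),(33,31),(35,29),(36,44),(38,46),(40,48),(42,50),(44,40),(46,42),(48,38),(50,36)],
    Cycle 27 134, Cycle 27 198, Split 24 [Cycle 24 38896, Cycle 24 55280, Cycle 24 47088, Cycle 24 63472,
    Cycle 24 8, Cycle 24 158, Cycle 24 222] [45,47] (Split 45 [Cycle 45 174, Cycle 45 238, Cycle 45 34786,
    Cycle 45 51170, Cycle 45 42978, Cycle 45 59362, Cycle 45 38882, Cycle 45 55266, Cycle 45 47074, Cycle 45
    63458, Cycle 45 36834, Cycle 45 53218, Cycle 45 10, Cycle 45 150, Cycle 45 214] [56,58] (Split 47 [Cycle
    47 8, Cycle 47 12, Cycle 47 174, Cycle 47 238, Cycle 47 34786, Cycle 47 51170, Cycle 47 42978, Cycle 47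
    59362, Cycle 47 38882, Cycle 47 55266, Cycle 47 47074, Cycle 47 63458, Cycle 47 36834, Cycle 47 53218,
    Cycle 47 10, Cycle 47 150, Cycle 47 214] [60,62] Overflow)), Known 0 [(24,26),(26,24)], Cycle 27 158,
    Cycle 27 222] [56,58] (Split 17 [Cycle 17 134, Cycle 17 198, Cycle 17 166, Cycle 17 230, Split 44 [Cycle
    44 38722, Cycle 44 55106, Cycle 44 46914, Cycle 44 63298, Cycle 44 130, Split 44 [Cycle 44 38755, Cycle 44
    55139, Cycle 44 46947, Cycle 44 63331, Cycle 44 10] [45] (Split 45 [Cycle 45 35806, Cycle 45 52190, Cycle
    45 43998, Cycle 45 60382, Cycle 45 8, Cycle 45 39870, Cycle 45 10, Cycle 45 142, Cycle 45 206, Cycle 45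
    174, Cycle 45 238, Cycle 45 36550, Cycle 45 52934, Cycle 45 36806, Cycle 45 53190, Cycle 45 140, Cycle 45
    204] [60,62] Overflow)] [45,47] (Split 45 [Cycle 45 35806, Cycle 45 52190, Cycle 45 43998, Cycle 45 60382,
    Cycle 45 44894, Cycle 45 35774, Cycle 45 10, Cycle 45 142, Cycle 45 206, Cycle 45 174, Cycle 45 238, Cycle
    45 36486, Cycle 45 52870, Cycle 45 36742, Cycle 45 53126, Cycle 45 40838, Cycle 45 57222] [60,62]
    Overflow), Known 0 [(48,50),(50,48)], Known 1 [(33,35),(35,33),(44,48),(46,50),(48,44),(50,46)], Known 2
    [(33,35),(35,33),(44,48),(46,50),(48,46),(50,44)], Known 3
    [(16,18),(18,16),(29,33),(31,35),(33,29),(35,31),(36,44),(38,46),(40,48),(42,50),(44,36),(46,38),(48,40),(50,42)],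
    Known 4
    [(16,18),(18,16),(29,33),(31,35),(33,29),(35,31),(36,44),(38,46),(40,48),(42,50),(44,36),(46,38),(48,42),(50,40)],
    Known 5
    [(16,18),(18,16),(29,33),(31,35),(33,31),(35,29),(36,44),(38,46),(40,48),(42,50),(44,40),(46,42),(48,36),(50,38)],
    Known 6
    [(16,18),(18,16),(29,33),(31,35),(33,31),(35,29),(36,44),(38,46),(40,48),(42,50),(44,40),(46,42),(48,38),(50,36)],
    Cycle 17 142, Cycle 17 206, Cycle 17 150, Cycle 17 214, Split 19 [Cycle 19 134, Cycle 19 198, Cycle 19
    166, Cycle 19 230, Cycle 19 33648, Cycle 19 50032, Cycle 19 41840, Cycle 19 58224, Cycle 19 37744, Cycle
    19 54128, Cycle 19 45936, Cycle 19 62320, Cycle 19 142, Cycle 19 206, Cycle 19 150, Cycle 19 214, Cycle 19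
    8, Split 17 [Cycle 17 135, Cycle 17 199, Cycle 17 167, Cycle 17 231, Cycle 17 33649, Cycle 17 50033, Cycle
    17 41841, Cycle 17 58225, Cycle 17 37745, Cycle 17 54129, Cycle 17 45937, Cycle 17 62321, Cycle 17 143,
    Cycle 17 207, Cycle 17 151, Cycle 17 215, Cycle 17 9] [60] Overflow] [60,62] Overflow, Known 0
    [(20,22),(22,20)]] [60,62] Overflow)))))))))))))))))))))))))"
  by (simp only: eval theta_def)

text \<open>Here \<open>theta\<close> is the last entry of \<open>K\<close>. The embeddings that
  move all of 2 to 9 at an index beyond the siblings are copies of it: a new edge has created a
  third path of length 3 between two vertices.\<close>

lemma check_fused_hexagons: "check [theta] fused_hexagons
   (Split 8 [Cycle 8 9, Cycle 8 152] [13] (Split 13 [Cycle 13 8, Cycle 13 154, Cycle 13 130] [12,14] (Split 7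
    [Cycle 7 130, Cycle 7 194, Cycle 7 10, Cycle 7 9] [16] (Split 11 [Cycle 11 128, Cycle 11 9, Cycle 11 13,
    Cycle 11 155, Cycle 11 8] [18] (Split 4 [Cycle 4 11] [15] (Split 5 [Cycle 5 167, Cycle 5 8, Cycle 5 135,
    Cycle 5 199, Cycle 5 11] [20] (Split 15 [Cycle 15 8, Cycle 15 166, Known 2
    [(2,7),(3,2),(4,3),(5,4),(6,5),(7,6),(8,15),(9,16)], Cycle 15 134, Cycle 15 198, Cycle 15 10, Cycle 15 12]
    [22,24] (Split 6 [Cycle 6 10] [17] (Split 17 [Cycle 17 156, Cycle 17 220, Cycle 17 10, Cycle 17 142, Cycle
    17 8, Cycle 17 132, Cycle 17 196, Cycle 17 228] [26,28] (Split 16 [Cycle 16 8] [19,21] (Split 9 [Cycle 9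
    159, Cycle 9 223, Cycle 9 157, Cycle 9 221, Cycle 9 166, Cycle 9 10, Cycle 9 8, Cycle 9 12, Cycle 9 11]
    [30] (Split 10 [Cycle 10 143, Cycle 10 207] [23] (Split 12 [Cycle 12 158, Cycle 12 142, Cycle 12 206]
    [25,27] (Split 14 [Cycle 14 8, Cycle 14 12, Cycle 14 158, Cycle 14 142, Cycle 14 206] [29,31] (Split 30 [
    Split 30 [Cycle 30 8, Known 1 [(2,13),(3,8),(4,9),(5,30),(6,31),(7,14),(8,27),(9,12)], Known 2
    [(2,13),(3,8),(4,9),(5,30),(6,31),(7,14),(8,25),(9,12)], Cycle 30 172, Split 31 [Cycle 31 150, Cycle 31
    214, Cycle 31 158, Cycle 31 222, Cycle 31 190, Cycle 31 174] [32] (Split 32 [Cycle 32 10, Cycle 32 164,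
    Cycle 32 228, Cycle 32 174, Cycle 32 8, Cycle 32 204] [33,35] (Split 18 [Cycle 18 150, Cycle 18 214, Cycle
    18 182, Cycle 18 40180, Cycle 18 56564, Cycle 18 8, Cycle 18 142, Cycle 18 206] [37,39] (Split 20 [Cycle
    20 150, Cycle 20 214, Cycle 20 33054, Cycle 20 49438, Cycle 20 41206, Cycle 20 40412, Cycle 20 56796,
    Cycle 20 156, Cycle 20 158, Cycle 20 222] [41,43] (Split 21 [Cycle 21 150, Cycle 21 214, Cycle 21 159,
    Cycle 21 223] [34] (Split 19 [Cycle 19 8, Cycle 19 40948, Cycle 19 57332, Cycle 19 158, Cycle 19 222]
    [36,38] (Split 23 [Cycle 23 172, Cycle 23 236, Cycle 23 142, Cycle 23 156, Cycle 23 220, Cycle 23 40390,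
    Cycle 23 56774] [40,42] (Split 29 [Cycle 29 150, Cycle 29 214, Cycle 29 148, Cycle 29 212, Cycle 29 142,
    Cycle 29 40654, Cycle 29 57038, Cycle 29 40940, Cycle 29 57324] [44,46] (Split 37 [Cycle 37 166, Cycle 37
    230, Cycle 37 36814, Cycle 37 53198, Cycle 37 37978, Cycle 37 54362, Cycle 37 142, Cycle 37 40654, Cycle
    37 57038, Cycle 37 138, Cycle 37 202] [48,50] (Split 39 [Cycle 39 8, Cycle 39 12, Cycle 39 166, Cycle 39
    230, Cycle 39 36814, Cycle 39 53198, Cycle 39 37978, Cycle 39 54362, Cycle 39 142, Cycle 39 40654, Cycle
    39 57038, Cycle 39 138, Cycle 39 202] [52,54] (Split 41 [Cycle 41 35646, Cycle 41 52030, Cycle 41 43838,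
    Cycle 41 60222, Cycle 41 41790, Cycle 41 58174, Cycle 41 142, Cycle 41 206, Cycle 41 170, Cycle 41 234,
    Cycle 41 138, Cycle 41 40174, Cycle 41 56558, Cycle 41 36554, Cycle 41 52938] [56,58] (Split 43 [Cycle 43
    8, Cycle 43 12, Cycle 43 35646, Cycle 43 52030, Cycle 43 43838, Cycle 43 60222, Cycle 43 41790, Cycle 43
    58174, Cycle 43 142, Cycle 43 206, Cycle 43 170, Cycle 43 234, Cycle 43 138, Cycle 43 40174, Cycle 43
    56558, Cycle 43 36554, Cycle 43 52938] [60,62] Overflow))))))))))), Known 0 [(19,21),(21,19)]] [33] (Split
    33 [Cycle 33 150, Cycle 33 214, Cycle 33 158, Cycle 33 222, Cycle 33 190, Cycle 33 174] [32,34] (Split 31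
    [Cycle 31 8, Cycle 31 12, Cycle 31 150, Cycle 31 214, Cycle 31 158, Cycle 31 222, Cycle 31 190, Cycle 31
    174] [36] (Split 22 [Cycle 22 46970, Split 27 [Cycle 27 175, Cycle 27 143, Cycle 27 207, Cycle 27 148,
    Cycle 27 212, Cycle 27 8, Cycle 27 49075, Cycle 27 172] [38] (Split 22 [Cycle 22 46971, Cycle 22 10, Cycle
    22 174, Cycle 22 159, Cycle 22 223] [35] (Split 18 [Cycle 18 170, Cycle 18 182, Cycle 18 48098, Cycle 18
    8, Cycle 18 142, Cycle 18 206] [37,39] (Split 26 [Cycle 26 36670, Cycle 26 53054, Cycle 26 174, Cycle 26
    47086, Cycle 26 56798, Cycle 26 158, Cycle 26 36846, Cycle 26 53230] [41,43] (Split 28 [Cycle 28 8, Cycle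
    28 12, Cycle 28 36670, Cycle 28 53054, Cycle 28 174, Cycle 28 47086, Cycle 28 56798, Cycle 28 158, Cycle
    28 36846, Cycle 28 53230] [45,47] (Split 19 [Cycle 19 36478, Cycle 19 162, Cycle 19 130, Cycle 19 194,
    Cycle 19 158, Cycle 19 186] [40,42] (Split 21 [Cycle 21 8, Cycle 21 12, Cycle 21 36478, Cycle 21 162,
    Cycle 21 130, Cycle 21 194, Cycle 21 158, Cycle 21 186] [44,46] (Split 23 [Cycle 23 140, Cycle 23 204,
    Cycle 23 172, Cycle 23 236, Cycle 23 150, Cycle 23 174, Cycle 23 142, Cycle 23 206, Cycle 23 40390, Cycle
    23 188] [48,50] (Split 32 [Cycle 32 35750, Cycle 32 52134, Cycle 32 43942, Cycle 32 60326, Cycle 32 150,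
    Cycle 32 214, Cycle 32 45046, Cycle 32 198, Cycle 32 230] [49,51] (Split 34 [Cycle 34 8, Cycle 34 12,
    Cycle 34 35750, Cycle 34 52134, Cycle 34 43942, Cycle 34 60326, Cycle 34 150, Cycle 34 214, Cycle 34
    45046, Cycle 34 198, Cycle 34 230] [53,55] (Split 36 [Cycle 36 33766, Cycle 36 50150, Cycle 36 41958,
    Cycle 36 58342, Cycle 36 36838, Cycle 36 53222, Cycle 36 45030, Cycle 36 61414, Cycle 36 142, Cycle 36
    206, Cycle 36 166, Cycle 36 10, Cycle 36 228] [57,59] (Split 38 [Cycle 38 134, Cycle 38 198, Cycle 38
    35004, Cycle 38 51388, Cycle 38 43196, Cycle 38 59580, Cycle 38 36838, Cycle 38 53222, Cycle 38 45030,
    Cycle 38 61414, Cycle 38 142, Cycle 38 206, Cycle 38 8, Cycle 38 52716, Cycle 38 10] [61,63]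
    Overflow))))))))))), Known 0 [(25,27),(27,25)], Cycle 22 44858, Cycle 22 158, Cycle 22 222] [35,37] (Split
    18 [Cycle 18 164, Cycle 18 228, Cycle 18 182, Cycle 18 40180, Cycle 18 56564, Cycle 18 8, Cycle 18 142,
    Cycle 18 206] [39,41] (Split 39 [Cycle 39 174, Cycle 39 142, Cycle 39 206, Cycle 39 40902, Cycle 39 57286,
    Cycle 39 138, Cycle 39 170] [38,40] (Split 32 [Cycle 32 150, Cycle 32 45046, Cycle 32 61430, Cycle 32 198,
    Cycle 32 166, Cycle 32 230, Cycle 32 158, Cycle 32 142, Cycle 32 206] [43,45] (Split 36 [ Split 36 [Cycle
    36 8, Cycle 36 143, Cycle 36 45039, Cycle 36 61423, Cycle 36 11, Cycle 36 165, Cycle 36 229, Cycle 36 175,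
    Cycle 36 141, Cycle 36 205] [47] (Split 24 [Cycle 24 35374, Cycle 24 55162, Cycle 24 59258, Cycle 24 150,
    Cycle 24 8, Cycle 24 12, Cycle 24 45686, Cycle 24 40078, Cycle 24 56462, Cycle 24 44858, Cycle 24 158,
    Cycle 24 222] [49,51] (Split 25 [Cycle 25 166, Cycle 25 230, Cycle 25 142, Cycle 25 40882, Cycle 25 57266,
    Cycle 25 49074] [42,44] (Split 27 [Cycle 27 8, Cycle 27 12, Cycle 27 166, Cycle 27 230, Cycle 27 142,
    Cycle 27 40882, Cycle 27 57266, Cycle 27 49074] [46,48] (Split 34 [Cycle 34 36854, Cycle 34 53238, Known 2
    [(2,33),(3,30),(4,31),(5,36),(6,45),(7,32),(8,47),(9,34)], Cycle 34 8, Cycle 34 12, Cycle 34 150, Cycle 34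
    45046, Cycle 34 61430, Cycle 34 198, Cycle 34 158, Cycle 34 142, Cycle 34 206] [53,55] (Split 41 [Cycle 41
    150, Cycle 41 214, Cycle 41 182, Cycle 41 246, Cycle 41 8, Cycle 41 12, Cycle 41 40902, Cycle 41 57286,
    Cycle 41 170] [50,52] (Split 43 [Cycle 43 35806, Cycle 43 52190, Cycle 43 38632, Cycle 43 55016, Cycle 43
    46824, Cycle 43 63208, Cycle 43 43998, Cycle 43 60382, Cycle 43 40950, Cycle 43 57334, Cycle 43 49014]
    [54,56] (Split 47 [Cycle 47 178, Cycle 47 242, Cycle 47 35802, Cycle 47 52186, Cycle 47 142, Cycle 47 206,
    Cycle 47 174, Cycle 47 238, Cycle 47 43994, Cycle 47 60378, Cycle 47 40888, Cycle 47 57272, Cycle 47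
    49080] [58,60] Overflow))))))), Known 0 [(43,45),(45,43)], Cycle 36 142, Cycle 36 45038, Cycle 36 61422,
    Cycle 36 10, Cycle 36 164, Cycle 36 228, Cycle 36 174, Cycle 36 140, Cycle 36 204] [47,49] (Split 41
    [Cycle 41 8, Cycle 41 12, Cycle 41 142, Cycle 41 40902, Cycle 41 57286, Cycle 41 138, Cycle 41 170]
    [42,44] (Split 43 [Cycle 43 35806, Cycle 43 52190, Cycle 43 43998, Cycle 43 60382, Cycle 43 10, Cycle 43
    40950, Cycle 43 57334, Cycle 43 40942, Cycle 43 49014] [46,48] (Split 45 [Cycle 45 8, Cycle 45 12, Cycle
    45 35806, Cycle 45 52190, Cycle 45 43998, Cycle 45 60382, Cycle 45 10, Cycle 45 40950, Cycle 45 57334,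
    Cycle 45 40942, Cycle 45 49014] [50,52] (Split 35 [Cycle 35 37982, Cycle 35 54366, Cycle 35 46174, Cycle
    35 62558, Cycle 35 34718, Cycle 35 51102, Cycle 35 42910, Cycle 35 59294, Cycle 35 36598, Cycle 35 150,
    Cycle 35 214, Cycle 35 10, Split 29 [Cycle 29 148, Cycle 29 212, Cycle 29 180, Cycle 29 244, Cycle 29 134,
    Cycle 29 198, Cycle 29 166, Cycle 29 230, Cycle 29 142, Cycle 29 33662, Cycle 29 50046, Cycle 29 41974,
    Cycle 29 47094] [54,56] (Split 37 [Cycle 37 42742, Cycle 37 59126, Cycle 37 37982, Cycle 37 54366, Cycle
    37 46174, Cycle 37 62558, Cycle 37 34718, Cycle 37 51102, Cycle 37 42910, Cycle 37 59294, Cycle 37 36598,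
    Cycle 37 150, Cycle 37 214, Cycle 37 10, Cycle 37 8] [58,60] Overflow)] [54,56] (Split 37 [Cycle 37 8,
    Cycle 37 12, Cycle 37 37982, Cycle 37 54366, Cycle 37 46174, Cycle 37 62558, Cycle 37 34718, Cycle 37
    51102, Cycle 37 42910, Cycle 37 59294, Cycle 37 36598, Cycle 37 150, Cycle 37 214, Cycle 37 10, Split 29
    [Cycle 29 47094, Cycle 29 63478, Cycle 29 148, Cycle 29 212, Cycle 29 180, Cycle 29 244, Cycle 29 134,
    Cycle 29 198, Cycle 29 166, Cycle 29 230, Cycle 29 142, Cycle 29 33150, Cycle 29 49534, Cycle 29 41974,
    Cycle 29 38902] [58,60] Overflow] [58,60] Overflow)))))))))))), Known 0 [(29,31),(31,29)], Known 1
    [(12,14),(14,12),(25,29),(27,31),(29,25),(31,27)], Known 2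
    [(12,14),(14,12),(25,29),(27,31),(29,27),(31,25)], Known 4
    [(2,9),(3,2),(4,3),(5,10),(6,11),(7,8),(8,23),(9,30)], Split 18 [Cycle 18 32884, Cycle 18 49268, Cycle 18
    41076, Cycle 18 57460, Cycle 18 8, Cycle 18 142, Cycle 18 206] [33,35] (Split 20 [Cycle 20 150, Cycle 20
    214, Cycle 20 36228, Cycle 20 52612, Cycle 20 44420, Cycle 20 60804, Cycle 20 156, Cycle 20 158, Cycle 20
    222] [37,39] (Split 21 [Cycle 21 148, Cycle 21 212, Cycle 21 159, Cycle 21 223] [32] (Split 33 [Cycle 33
    142, Cycle 33 154, Cycle 33 40654, Cycle 33 57038, Cycle 33 138, Cycle 33 202] [34,36] (Split 35 [Cycle 35
    8, Cycle 35 12, Cycle 35 142, Cycle 35 154, Cycle 35 40654, Cycle 35 57038, Cycle 35 138, Cycle 35 202]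
    [38,40] (Split 37 [Cycle 37 35134, Cycle 37 51518, Cycle 37 43326, Cycle 37 59710, Cycle 37 138, Cycle 37
    158, Cycle 37 40174, Cycle 37 56558, Cycle 37 36426, Cycle 37 52810] [42,44] (Split 39 [Cycle 39 8, Cycle
    39 12, Cycle 39 35134, Cycle 39 51518, Cycle 39 43326, Cycle 39 59710, Cycle 39 138, Cycle 39 158, Cycle
    39 40174, Cycle 39 56558, Cycle 39 36426, Cycle 39 52810] [46,48] (Split 32 [Cycle 32 128, Cycle 32 192,
    Cycle 32 160, Cycle 32 224, Cycle 32 150, Cycle 32 10] [41,43] (Split 41 [Cycle 41 35790, Cycle 41 52174,
    Cycle 41 43982, Cycle 41 60366, Cycle 41 36350, Cycle 41 52734, Cycle 41 44542, Cycle 41 60926, Cycle 41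
    10, Cycle 41 158, Cycle 41 222, Cycle 41 40930, Cycle 41 57314] [50,52] (Split 34 [Cycle 34 34814, Cycle
    34 142, Cycle 34 206, Cycle 34 174, Cycle 34 238, Cycle 34 40862, Cycle 34 41942] [45,47] (Split 36 [Cycle
    36 8, Cycle 36 12, Cycle 36 34814, Cycle 36 142, Cycle 36 206, Cycle 36 174, Cycle 36 238, Cycle 36 40862,
    Cycle 36 41942] [49,51] (Split 42 [Cycle 42 38038, Cycle 42 54422, Cycle 42 46230, Cycle 42 62614, Cycle
    42 33758, Cycle 42 33406, Cycle 42 49790, Cycle 42 41598, Cycle 42 57982, Cycle 42 158, Cycle 42 214]
    [53,55] (Split 44 [Cycle 44 8, Cycle 44 12, Cycle 44 38038, Cycle 44 54422, Cycle 44 46230, Cycle 44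
    62614, Cycle 44 33758, Cycle 44 33406, Cycle 44 49790, Cycle 44 41598, Cycle 44 57982, Cycle 44 158, Cycle
    44 214] [57,59] (Split 50 [Cycle 50 38342, Cycle 50 54726, Cycle 50 46534, Cycle 50 62918, Cycle 50 38398,
    Cycle 50 54782, Cycle 50 46590, Cycle 50 62974, Cycle 50 10, Cycle 50 35838, Cycle 50 52222, Cycle 50
    44030, Cycle 50 60414, Cycle 50 48126, Cycle 50 56774] [61,63] Overflow))))))))))))), Known 0
    [(19,21),(21,19)]] [33,35] (Split 33 [Cycle 33 150, Cycle 33 214, Cycle 33 158, Cycle 33 222, Cycle 33
    190, Cycle 33 174] [32,34] (Split 35 [Cycle 35 8, Cycle 35 12, Cycle 35 150, Cycle 35 214, Cycle 35 158,
    Cycle 35 222, Cycle 35 190, Cycle 35 174] [36,38] (Split 32 [Cycle 32 134, Cycle 32 198, Cycle 32 166,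
    Cycle 32 230, Cycle 32 158, Cycle 32 142, Cycle 32 206] [37,39] (Split 23 [Cycle 23 142, Cycle 23 206,
    Cycle 23 174, Cycle 23 156, Cycle 23 220, Split 24 [Cycle 24 46971, Cycle 24 63355, Cycle 24 140, Cycle 24
    204, Cycle 24 172, Cycle 24 236, Cycle 24 159, Cycle 24 223] [41] (Split 18 [Cycle 18 132, Cycle 18 182,
    Cycle 18 246, Cycle 18 35760, Cycle 18 52144, Cycle 18 43952, Cycle 18 60336, Cycle 18 8, Cycle 18 142,
    Cycle 18 206] [43,45] (Split 22 [Cycle 22 150, Cycle 22 214, Cycle 22 8, Cycle 22 46970, Cycle 22 63354,
    Cycle 22 35780, Cycle 22 52164, Cycle 22 43972, Cycle 22 60356, Cycle 22 12, Cycle 22 158, Cycle 22 222]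
    [47,49] (Split 26 [Cycle 26 174, Cycle 26 238, Cycle 26 39502, Cycle 26 55886, Cycle 26 142, Cycle 26
    46926, Cycle 26 63310, Cycle 26 35406, Cycle 26 51790, Cycle 26 43598, Cycle 26 59982, Cycle 26 158, Cycle
    26 36686, Cycle 26 53070] [51,53] (Split 28 [Cycle 28 8, Cycle 28 12, Cycle 28 174, Cycle 28 238, Cycle 28
    39502, Cycle 28 55886, Cycle 28 142, Cycle 28 46926, Cycle 28 63310, Cycle 28 35406, Cycle 28 51790, Cycle
    28 43598, Cycle 28 59982, Cycle 28 158, Cycle 28 36686, Cycle 28 53070] [55,57] (Split 34 [Cycle 34 35614,
    Cycle 34 51998, Cycle 34 43806, Cycle 34 60190, Cycle 34 37358, Cycle 34 53742, Cycle 34 150, Cycle 34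
    214, Cycle 34 36854, Cycle 34 8, Cycle 34 12, Cycle 34 134, Cycle 34 198, Cycle 34 166, Cycle 34 230,
    Cycle 34 158, Cycle 34 142, Cycle 34 206] [59,61] Overflow))))), Known 0 [(22,24),(24,22)], Cycle 23 188,
    Cycle 23 10] [40,42] (Split 34 [Cycle 34 8, Cycle 34 12, Cycle 34 134, Cycle 34 198, Cycle 34 166, Cycle
    34 230, Cycle 34 142, Cycle 34 206] [41,43] (Split 19 [Cycle 19 138, Cycle 19 202, Cycle 19 130, Cycle 19
    194, Split 22 [Cycle 22 38778, Cycle 22 55162, Cycle 22 46970, Cycle 22 63354, Cycle 22 35082, Cycle 22
    51466, Cycle 22 43274, Cycle 22 59658, Cycle 22 158, Cycle 22 222] [45,47] (Split 24 [Cycle 24 8, Cycle 24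
    12, Cycle 24 38778, Cycle 24 55162, Cycle 24 46970, Cycle 24 63354, Cycle 24 35082, Cycle 24 51466, Cycle
    24 43274, Cycle 24 59658, Cycle 24 158, Cycle 24 222] [49,51] (Split 26 [Cycle 26 142, Cycle 26 206, Cycle
    26 174, Cycle 26 238, Cycle 26 37872, Cycle 26 54256, Cycle 26 46064, Cycle 26 62448, Cycle 26 35824,
    Cycle 26 52208, Cycle 26 44016, Cycle 26 60400, Known 16
    [(2,17),(3,6),(4,7),(5,16),(6,19),(7,28),(8,21),(9,26)], Cycle 26 8] [53,55] (Split 19 [Cycle 19 139,
    Cycle 19 203, Cycle 19 131, Cycle 19 195, Cycle 19 187, Cycle 19 171] [44] (Split 21 [Cycle 21 8, Cycle 21
    138, Cycle 21 202, Cycle 21 130, Cycle 21 194, Cycle 21 12, Cycle 21 186, Cycle 21 170] [46,48] (Split 53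
    [Cycle 53 134, Cycle 53 198, Cycle 53 166, Split 42 [Cycle 42 8, Cycle 42 131, Cycle 42 195, Cycle 42 163,
    Cycle 42 227, Cycle 42 38780, Cycle 42 55164, Cycle 42 46972, Cycle 42 63356, Cycle 42 143, Cycle 42 207,
    Cycle 42 175, Cycle 42 239] [57] (Split 18 [Cycle 18 37748, Cycle 18 144, Cycle 18 52734, Cycle 18 132,
    Cycle 18 196, Cycle 18 164, Cycle 18 228, Cycle 18 150, Cycle 18 214, Cycle 18 182, Cycle 18 246, Cycle 18
    35536, Cycle 18 51920, Cycle 18 43728, Cycle 18 60112] [59,61] Overflow), Known 0 [(40,42),(42,40)], Cycle
    53 34802, Cycle 53 51186, Cycle 53 10, Cycle 53 44850, Cycle 53 47090] [50,52] (Split 50 [Cycle 50 10,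
    Cycle 50 34734, Cycle 50 51118, Cycle 50 42926, Cycle 50 59310, Cycle 50 38782, Cycle 50 55166, Cycle 50
    46974, Cycle 50 63358, Cycle 50 36198, Cycle 50 52582, Cycle 50 44390, Cycle 50 60774] [57,59] (Split 52
    [Cycle 52 8, Cycle 52 12, Cycle 52 10, Cycle 52 34734, Cycle 52 51118, Cycle 52 42926, Cycle 52 59310,
    Cycle 52 38782, Cycle 52 55166, Cycle 52 46974, Cycle 52 63358, Cycle 52 36198, Cycle 52 52582, Cycle 52
    44390, Cycle 52 60774] [61,63] Overflow))))))), Known 0 [(26,28),(28,26)], Cycle 19 158, Cycle 19 222,
    Cycle 19 186, Cycle 19 170] [44,46] (Split 22 [Cycle 22 38778, Cycle 22 55162, Cycle 22 46970, Cycle 22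
    63354, Split 21 [Cycle 21 8, Cycle 21 12, Cycle 21 138, Cycle 21 202, Cycle 21 130, Cycle 21 194, Cycle 21
    37906, Cycle 21 54290, Cycle 21 158, Cycle 21 222, Cycle 21 186, Cycle 21 170] [48,50] (Split 40 [Cycle 40
    38690, Cycle 40 55074, Cycle 40 46882, Cycle 40 63266, Cycle 40 142, Cycle 40 206, Cycle 40 174, Cycle 40
    238] [45,47] (Split 42 [Cycle 42 8, Cycle 42 12, Cycle 42 38690, Cycle 42 55074, Cycle 42 46882, Cycle 42
    63266, Cycle 42 142, Cycle 42 206, Cycle 42 174, Cycle 42 238] [49,51] (Split 24 [Cycle 24 134, Cycle 24
    198, Cycle 24 166, Cycle 24 230, Cycle 24 38778, Cycle 24 55162, Cycle 24 46970, Cycle 24 63354, Cycle 24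
    8, Split 22 [Cycle 22 135, Cycle 22 199, Cycle 22 167, Cycle 22 231, Cycle 22 38779, Cycle 22 55163, Cycle
    22 46971, Cycle 22 63355, Cycle 22 9, Cycle 22 145, Cycle 22 209] [53] (Split 53 [Cycle 53 36706, Cycle 53
    53090, Cycle 53 44898, Cycle 53 61282, Cycle 53 36598, Cycle 53 52982, Cycle 53 150, Cycle 53 214, Cycle
    53 10, Cycle 53 48994, Cycle 53 174] [52,54] (Split 52 [Cycle 52 36590, Cycle 52 52974, Cycle 52 44782,
    Cycle 52 61166, Cycle 52 37810, Cycle 52 54194, Cycle 52 46002, Cycle 52 62386, Cycle 52 10, Cycle 52
    52718, Cycle 52 146, Cycle 52 210] [55,57] (Split 54 [Cycle 54 8, Cycle 54 12, Cycle 54 36590, Cycle 54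
    52974, Cycle 54 44782, Cycle 54 61166, Cycle 54 37810, Cycle 54 54194, Cycle 54 46002, Cycle 54 62386,
    Cycle 54 10, Cycle 54 52718, Cycle 54 146, Cycle 54 210] [59,61] Overflow))), Cycle 24 144, Cycle 24 208]
    [53,55] (Split 53 [Cycle 53 36706, Cycle 53 53090, Cycle 53 44898, Cycle 53 61282, Cycle 53 36598, Cycle
    53 52982, Cycle 53 150, Cycle 53 214, Cycle 53 10, Cycle 53 48994, Cycle 53 174] [52,54] (Split 55 [Cycle
    55 8, Cycle 55 12, Cycle 55 36706, Cycle 55 53090, Cycle 55 44898, Cycle 55 61282, Cycle 55 36598, Cycle
    55 52982, Cycle 55 150, Cycle 55 214, Cycle 55 10, Cycle 55 48994, Cycle 55 174] [56,58] (Split 29 [Cycle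
    29 128, Cycle 29 192, Cycle 29 160, Cycle 29 224, Cycle 29 34736, Cycle 29 51120, Cycle 29 42928, Cycle 29
    59312, Cycle 29 142, Cycle 29 206, Cycle 29 38832, Cycle 29 55216, Cycle 29 8, Cycle 29 144, Split 29
    [Cycle 29 129, Cycle 29 193, Cycle 29 161, Cycle 29 225, Cycle 29 34737, Cycle 29 51121, Cycle 29 42929,
    Cycle 29 59313, Cycle 29 143, Cycle 29 207, Cycle 29 38833, Cycle 29 55217, Cycle 29 9, Cycle 29 145] [60]
    Overflow] [60,62] Overflow)))))), Known 0 [(29,31),(31,29)], Known 1
    [(12,14),(14,12),(25,29),(27,31),(29,25),(31,27)], Known 2
    [(12,14),(14,12),(25,29),(27,31),(29,27),(31,25)], Cycle 22 158] [45,47] (Split 24 [Cycle 24 8, Cycle 24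
    12, Cycle 24 38778, Cycle 24 55162, Cycle 24 46970, Cycle 24 63354, Split 21 [Cycle 21 8, Cycle 21 12,
    Cycle 21 138, Cycle 21 202, Cycle 21 130, Cycle 21 194, Cycle 21 37906, Cycle 21 54290, Cycle 21 158,
    Cycle 21 186, Cycle 21 170] [48,50] (Split 40 [Cycle 40 162, Cycle 40 226, Cycle 40 38658, Cycle 40 55042,
    Cycle 40 46850, Cycle 40 63234, Cycle 40 142, Cycle 40 206, Cycle 40 174, Cycle 40 238] [49,51] (Split 42
    [Cycle 42 8, Cycle 42 12, Cycle 42 162, Cycle 42 226, Cycle 42 38658, Cycle 42 55042, Cycle 42 46850,
    Cycle 42 63234, Cycle 42 142, Cycle 42 206, Cycle 42 174, Cycle 42 238] [53,55] (Split 45 [Cycle 45 36706,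
    Cycle 45 53090, Cycle 45 44898, Cycle 45 61282, Cycle 45 36598, Cycle 45 52982, Cycle 45 150, Cycle 45
    214, Cycle 45 10, Cycle 45 48994, Cycle 45 174] [52,54] (Split 47 [Cycle 47 8, Cycle 47 12, Cycle 47
    36706, Cycle 47 53090, Cycle 47 44898, Cycle 47 61282, Cycle 47 36598, Cycle 47 52982, Cycle 47 150, Cycle
    47 214, Cycle 47 10, Cycle 47 48994, Cycle 47 174] [56,58] (Split 29 [Cycle 29 128, Cycle 29 192, Cycle 29
    160, Cycle 29 224, Cycle 29 34736, Cycle 29 51120, Cycle 29 42928, Cycle 29 59312, Cycle 29 142, Cycle 29
    206, Cycle 29 38832, Cycle 29 55216, Cycle 29 8, Cycle 29 144, Split 29 [Cycle 29 129, Cycle 29 193, Cycle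
    29 161, Cycle 29 225, Cycle 29 34737, Cycle 29 51121, Cycle 29 42929, Cycle 29 59313, Cycle 29 143, Cycle
    29 207, Cycle 29 38833, Cycle 29 55217, Cycle 29 9, Cycle 29 145] [60] Overflow] [60,62] Overflow))))),
    Known 0 [(29,31),(31,29)], Known 1 [(12,14),(14,12),(25,29),(27,31),(29,25),(31,27)], Known 2
    [(12,14),(14,12),(25,29),(27,31),(29,27),(31,25)], Cycle 24 158] [49,51] (Split 36 [Cycle 36 36854, Cycle
    36 53238, Cycle 36 45046, Cycle 36 61430, Split 36 [Cycle 36 36855, Cycle 36 53239, Cycle 36 45047, Cycle
    36 61431, Cycle 36 8, Known 9 [(2,33),(3,30),(4,35),(5,36),(6,43),(7,34),(8,39),(9,32)], Known 10
    [(2,33),(3,30),(4,35),(5,36),(6,43),(7,34),(8,37),(9,32)], Cycle 36 135, Cycle 36 199, Cycle 36 167, Cycle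
    36 231, Cycle 36 143] [53] (Split 38 [Cycle 38 8, Cycle 38 36854, Cycle 38 53238, Cycle 38 45046, Cycle 38
    61430, Cycle 38 12, Known 10 [(2,35),(3,30),(4,33),(5,34),(6,41),(7,38),(8,43),(9,36)], Cycle 38 148,
    Cycle 38 212, Cycle 38 134, Cycle 38 198, Cycle 38 166, Cycle 38 230, Cycle 38 142] [55,57] (Split 41
    [Cycle 41 44782, Cycle 41 61166, Cycle 41 36728, Cycle 41 53112, Cycle 41 40888, Cycle 41 57272, Cycle 41
    49080, Cycle 41 174] [48,50] (Split 48 [Cycle 48 142, Cycle 48 206, Cycle 48 174, Cycle 48 36594, Cycle 48
    52978, Cycle 48 44786, Cycle 48 61170, Cycle 48 10, Split 50 [Cycle 50 142, Cycle 50 206, Cycle 50 174,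
    Cycle 50 36594, Cycle 50 52978, Cycle 50 44786, Cycle 50 61170, Cycle 50 10, Cycle 50 8, Known 21
    [(2,32),(3,33),(4,34),(5,41),(6,48),(7,39),(8,50),(9,37)], Cycle 50 36338, Cycle 50 52722, Cycle 50 44530,
    Cycle 50 60914, Cycle 50 40414] [59,61] Overflow, Known 0 [(37,39),(39,37)], Cycle 48 36338, Cycle 48
    52722, Cycle 48 44530, Cycle 48 60914, Cycle 48 40414] [59,61] Overflow))), Known 0 [(41,43),(43,41)],
    Known 1 [(32,34),(34,32),(37,41),(39,43),(41,37),(43,39)], Known 2
    [(32,34),(34,32),(37,41),(39,43),(41,39),(43,37)], Cycle 36 134, Cycle 36 198, Cycle 36 166, Cycle 36 230,
    Cycle 36 142] [53,55] (Split 38 [Cycle 38 8, Cycle 38 12, Cycle 38 36854, Cycle 38 53238, Cycle 38 45046,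
    Cycle 38 61430, Split 38 [Cycle 38 9, Cycle 38 13, Cycle 38 36855, Cycle 38 53239, Cycle 38 45047, Cycle
    38 61431, Cycle 38 8, Known 13 [(2,33),(3,30),(4,35),(5,38),(6,43),(7,34),(8,39),(9,32)], Known 14
    [(2,33),(3,30),(4,35),(5,38),(6,43),(7,34),(8,37),(9,32)], Cycle 38 135, Cycle 38 199, Cycle 38 167, Cycle
    38 231, Cycle 38 143] [57] (Split 41 [Cycle 41 44782, Cycle 41 61166, Cycle 41 36728, Cycle 41 53112,
    Cycle 41 40888, Cycle 41 57272, Cycle 41 49080, Cycle 41 174] [48,50] (Split 48 [Cycle 48 142, Cycle 48
    174, Cycle 48 238, Cycle 48 36594, Cycle 48 52978, Cycle 48 44786, Cycle 48 61170, Cycle 48 10, Split 50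
    [Cycle 50 142, Cycle 50 174, Cycle 50 238, Cycle 50 36594, Cycle 50 52978, Cycle 50 44786, Cycle 50 61170,
    Cycle 50 10, Cycle 50 8, Known 23 [(2,32),(3,33),(4,34),(5,41),(6,48),(7,39),(8,50),(9,37)], Cycle 50
    36338, Cycle 50 52722, Cycle 50 44530, Cycle 50 60914, Cycle 50 40414] [59,61] Overflow, Known 0
    [(37,39),(39,37)], Cycle 48 36338, Cycle 48 52722, Cycle 48 44530, Cycle 48 60914, Cycle 48 40414] [59,61]
    Overflow)), Known 0 [(41,43),(43,41)], Known 1 [(32,34),(34,32),(37,41),(39,43),(41,37),(43,39)], Known 2
    [(32,34),(34,32),(37,41),(39,43),(41,39),(43,37)], Cycle 38 134, Cycle 38 198, Cycle 38 166, Cycle 38 230,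
    Cycle 38 142] [57,59] (Split 18 [Cycle 18 134, Cycle 18 198, Cycle 18 166, Cycle 18 230, Cycle 18 132,
    Cycle 18 196, Cycle 18 164, Cycle 18 228, Cycle 18 150, Cycle 18 214, Cycle 18 182, Cycle 18 246, Split 18
    [Cycle 18 135, Cycle 18 199, Cycle 18 167, Cycle 18 231, Cycle 18 133, Cycle 18 197, Cycle 18 165, Cycle
    18 229, Cycle 18 151, Cycle 18 215, Cycle 18 183, Cycle 18 247, Cycle 18 8, Known 25
    [(2,13),(3,8),(4,11),(5,18),(6,31),(7,14),(8,27),(9,12)], Known 26
    [(2,13),(3,8),(4,11),(5,18),(6,31),(7,14),(8,25),(9,12)], Cycle 18 143] [61] Overflow, Known 0
    [(29,31),(31,29)], Known 1 [(12,14),(14,12),(25,29),(27,31),(29,25),(31,27)], Known 2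
    [(12,14),(14,12),(25,29),(27,31),(29,27),(31,25)], Cycle 18 142] [61,63] Overflow))))))))))))))))))))))))))"
  by (simp only: eval fused_hexagons_def theta_def)

text \<open>After six splits every vertex of the hexagon has its own outer neighbour. An edge
  between the outer neighbours of antipodal vertices makes a third path of length 3 and is refuted
  by \<open>theta\<close>. An edge between second outer neighbours above adjacent vertices of the
  hexagon closes a second hexagon on their common edge and is refuted by
  \<open>fused_hexagons\<close>.\<close>

lemma check_hexagon: "check [fused_hexagons, theta] hexagon
   (Split 4 [Cycle 4 9] [9] (Split 2 [Cycle 2 9, Cycle 2 13] [11] (Split 3 [Cycle 3 11] [8] (Split 5 [Cycle 5
    11] [10] (Split 6 [Cycle 6 8, Cycle 6 11] [13] (Split 7 [Cycle 7 11, Cycle 7 10] [12] (Split 9 [Known 1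
    [(2,7),(3,2),(4,3),(5,4),(6,5),(7,6),(8,9),(9,12)], Cycle 9 8, Cycle 9 10] [14,16] (Split 11 [Cycle 11
    156, Cycle 11 220, Cycle 11 8, Known 4 [(8,10),(9,11)], Cycle 11 10] [18,20] (Split 8 [Known 1
    [(2,3),(3,2),(4,7),(5,6),(6,5),(7,4),(8,13),(9,8)]] [15,17] (Split 10 [Cycle 10 156, Cycle 10 220, Cycle
    10 8] [19,21] (Split 13 [Cycle 13 158, Cycle 13 222, Cycle 13 156, Cycle 13 220, Cycle 13 8] [22,24]
    (Split 12 [Cycle 12 156, Cycle 12 220, Cycle 12 158, Cycle 12 222] [23,25] (Split 14 [Cycle 14 158, Cycle
    14 222, Known 2 [(2,5),(3,4),(4,3),(5,2),(6,7),(7,6),(8,21),(9,10),(10,9),(11,14)], Known 3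
    [(2,5),(3,4),(4,3),(5,2),(6,7),(7,6),(8,19),(9,10),(10,9),(11,14)], Known 4
    [(2,4),(4,2),(5,7),(7,5),(8,14),(10,8),(11,17)], Known 5 [(2,4),(4,2),(5,7),(7,5),(8,14),(10,8),(11,15)]]
    [27,29] (Split 16 [Cycle 16 8, Cycle 16 12, Cycle 16 158, Cycle 16 222, Known 4
    [(2,5),(3,4),(4,3),(5,2),(6,7),(7,6),(8,21),(9,10),(10,9),(11,16)], Known 5
    [(2,5),(3,4),(4,3),(5,2),(6,7),(7,6),(8,19),(9,10),(10,9),(11,16)], Known 6
    [(2,4),(4,2),(5,7),(7,5),(8,16),(10,8),(11,17)], Known 7 [(2,4),(4,2),(5,7),(7,5),(8,16),(10,8),(11,15)]]
    [31,33] (Split 18 [Cycle 18 142, Cycle 18 206, Cycle 18 174, Cycle 18 238, Known 4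
    [(2,7),(3,2),(4,3),(5,4),(6,5),(7,6),(8,25),(9,12),(10,11),(11,18)], Known 5
    [(2,7),(3,2),(4,3),(5,4),(6,5),(7,6),(8,23),(9,12),(10,11),(11,18)], Cycle 18 158, Cycle 18 222, Known 8
    [(2,3),(3,2),(4,7),(5,6),(6,5),(7,4),(8,17),(9,8),(10,11),(11,18)], Known 9
    [(2,3),(3,2),(4,7),(5,6),(6,5),(7,4),(8,15),(9,8),(10,11),(11,18)]] [35,37] (Split 20 [Cycle 20 8, Cycle
    20 12, Cycle 20 142, Cycle 20 206, Cycle 20 174, Cycle 20 238, Known 6
    [(2,7),(3,2),(4,3),(5,4),(6,5),(7,6),(8,25),(9,12),(10,11),(11,20)], Known 7
    [(2,7),(3,2),(4,3),(5,4),(6,5),(7,6),(8,23),(9,12),(10,11),(11,20)], Cycle 20 158, Cycle 20 222, Known 10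
    [(2,3),(3,2),(4,7),(5,6),(6,5),(7,4),(8,17),(9,8),(10,11),(11,20)], Known 11
    [(2,3),(3,2),(4,7),(5,6),(6,5),(7,4),(8,15),(9,8),(10,11),(11,20)]] [39,41] (Split 15 [Cycle 15 158, Cycle
    15 222] [26,28] (Split 17 [Cycle 17 8, Cycle 17 12, Cycle 17 158, Cycle 17 222] [30,32] (Split 19 [Cycle
    19 142, Cycle 19 206, Cycle 19 174, Cycle 19 238, Known 4 [(2,6),(3,5),(5,3),(6,2),(8,24),(9,13),(11,19)],
    Known 5 [(2,6),(3,5),(5,3),(6,2),(8,22),(9,13),(11,19)]] [34,36] (Split 21 [Cycle 21 8, Cycle 21 12, Cycle
    21 142, Cycle 21 206, Cycle 21 174, Cycle 21 238, Known 6 [(2,6),(3,5),(5,3),(6,2),(8,24),(9,13),(11,21)],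
    Known 7 [(2,6),(3,5),(5,3),(6,2),(8,22),(9,13),(11,21)]] [38,40] (Split 22 [Cycle 22 138, Cycle 22 202,
    Cycle 22 170, Cycle 22 234, Cycle 22 142, Cycle 22 206, Cycle 22 174, Cycle 22 238, Known 8
    [(2,7),(3,6),(4,5),(5,4),(6,3),(7,2),(8,25),(9,12),(10,13),(11,22)], Known 9
    [(2,7),(3,6),(4,5),(5,4),(6,3),(7,2),(8,23),(9,12),(10,13),(11,22)]] [43,45] (Split 24 [Cycle 24 8, Cycle
    24 12, Cycle 24 138, Cycle 24 202, Cycle 24 170, Cycle 24 234, Cycle 24 142, Cycle 24 206, Cycle 24 174,
    Cycle 24 238, Known 10 [(2,7),(3,6),(4,5),(5,4),(6,3),(7,2),(8,25),(9,12),(10,13),(11,24)], Known 11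
    [(2,7),(3,6),(4,5),(5,4),(6,3),(7,2),(8,23),(9,12),(10,13),(11,24)]] [47,49] (Split 23 [Cycle 23 142,
    Cycle 23 206, Cycle 23 174, Cycle 23 238, Cycle 23 138, Cycle 23 202, Cycle 23 170, Cycle 23 234] [42,44]
    (Split 25 [Cycle 25 8, Cycle 25 12, Cycle 25 142, Cycle 25 206, Cycle 25 174, Cycle 25 238, Cycle 25 138,
    Cycle 25 202, Cycle 25 170, Cycle 25 234] [46,48] (Split 27 [ Split 35 [Cycle 35 134, Cycle 35 198, Cycle
    35 166, Cycle 35 230, Cycle 35 34310, Cycle 35 50694, Cycle 35 42502, Cycle 35 58886, Cycle 35 142, Cycle
    35 206, Cycle 35 174, Cycle 35 238] [50,52] (Split 37 [Cycle 37 8, Cycle 37 12, Cycle 37 134, Cycle 37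
    198, Cycle 37 166, Cycle 37 230, Cycle 37 34310, Cycle 37 50694, Cycle 37 42502, Cycle 37 58886, Cycle 37
    142, Cycle 37 206, Cycle 37 174, Cycle 37 238] [54,56] (Split 39 [ Split 41 [Cycle 41 8, Known 2
    [(2,20),(3,11),(4,18),(5,37),(6,54),(7,41),(8,56),(9,39)], Cycle 41 144, Cycle 41 208, Cycle 41 134, Cycle
    41 198, Cycle 41 166, Cycle 41 230, Cycle 41 34310, Cycle 41 50694, Cycle 41 42502, Cycle 41 58886, Cycle
    41 142, Cycle 41 206, Cycle 41 174, Cycle 41 238] [58,60] Overflow, Known 0 [(54,56),(56,54)], Known 1
    [(35,37),(37,35),(50,54),(52,56),(54,50),(56,52)], Known 2
    [(35,37),(37,35),(50,54),(52,56),(54,52),(56,50)], Cycle 39 134, Cycle 39 198, Cycle 39 166, Cycle 39 230,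
    Cycle 39 34310, Cycle 39 50694, Cycle 39 42502, Cycle 39 58886, Cycle 39 142, Cycle 39 206, Cycle 39 174,
    Cycle 39 238] [58,60] Overflow)), Known 0 [(46,48),(48,46)], Known 1
    [(23,25),(25,23),(42,46),(44,48),(46,42),(48,44)], Known 2
    [(23,25),(25,23),(42,46),(44,48),(46,44),(48,42)], Cycle 27 134, Cycle 27 198, Cycle 27 166, Cycle 27 230,
    Cycle 27 142, Cycle 27 206, Cycle 27 174, Cycle 27 238] [50,52] (Split 29 [Cycle 29 8, Cycle 29 12, Split
    35 [Cycle 35 33022, Cycle 35 49406, Cycle 35 134, Cycle 35 198, Cycle 35 166, Cycle 35 230, Cycle 35
    34310, Cycle 35 50694, Cycle 35 42502, Cycle 35 58886, Cycle 35 142, Cycle 35 206, Cycle 35 174, Cycle 35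
    238] [54,56] (Split 37 [Cycle 37 8, Cycle 37 12, Cycle 37 33022, Cycle 37 49406, Cycle 37 134, Cycle 37
    198, Cycle 37 166, Cycle 37 230, Cycle 37 34310, Cycle 37 50694, Cycle 37 42502, Cycle 37 58886, Cycle 37
    142, Cycle 37 206, Cycle 37 174, Cycle 37 238] [58,60] Overflow), Known 0 [(46,48),(48,46)], Known 1
    [(23,25),(25,23),(42,46),(44,48),(46,42),(48,44)], Known 2
    [(23,25),(25,23),(42,46),(44,48),(46,44),(48,42)], Cycle 29 134, Cycle 29 198, Cycle 29 166, Cycle 29 230,
    Cycle 29 142, Cycle 29 206, Cycle 29 174, Cycle 29 238] [54,56] (Split 35 [ Split 37 [Cycle 37 8, Split 35
    [Cycle 35 9, Cycle 35 145, Cycle 35 209, Cycle 35 135, Cycle 35 199, Cycle 35 167, Cycle 35 231, Cycle 35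
    36849, Cycle 35 53233, Cycle 35 45041, Cycle 35 61425, Cycle 35 143, Cycle 35 207, Cycle 35 175, Cycle 35
    239] [58] (Split 37 [Cycle 37 9, Cycle 37 13, Cycle 37 149, Cycle 37 213, Cycle 37 135, Cycle 37 199,
    Cycle 37 167, Cycle 37 231, Cycle 37 36853, Cycle 37 53237, Cycle 37 45045, Cycle 37 61429, Cycle 37 143,
    Cycle 37 207, Cycle 37 175, Cycle 37 239] [60] Overflow), Cycle 37 144, Cycle 37 208, Cycle 37 134, Cycle
    37 198, Cycle 37 166, Cycle 37 230, Cycle 37 36848, Cycle 37 53232, Cycle 37 45040, Cycle 37 61424, Cycle
    37 142, Cycle 37 206, Cycle 37 174, Cycle 37 238] [58,60] Overflow, Known 0 [(54,56),(56,54)], Known 1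
    [(27,29),(29,27),(50,54),(52,56),(54,50),(56,52)], Known 2
    [(27,29),(29,27),(50,54),(52,56),(54,52),(56,50)], Cycle 35 134, Cycle 35 198, Cycle 35 166, Cycle 35 230,
    Split 31 [ Split 33 [Cycle 33 8, Known 10 [(2,16),(3,9),(4,14),(5,29),(6,54),(7,33),(8,56),(9,31)], Cycle
    33 144, Cycle 33 208, Cycle 33 34310, Cycle 33 50694, Cycle 33 42502, Cycle 33 58886, Cycle 33 134, Cycle
    33 198, Cycle 33 166, Cycle 33 230, Cycle 33 142, Cycle 33 206, Cycle 33 174, Cycle 33 238] [58,60]
    Overflow, Known 0 [(54,56),(56,54)], Known 1 [(27,29),(29,27),(50,54),(52,56),(54,50),(56,52)], Known 2
    [(27,29),(29,27),(50,54),(52,56),(54,52),(56,50)], Cycle 31 34310, Cycle 31 50694, Cycle 31 42502, Cycle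
    31 58886, Cycle 31 134, Cycle 31 198, Cycle 31 166, Cycle 31 230, Cycle 31 142, Cycle 31 206, Cycle 31
    174, Cycle 31 238] [58,60] Overflow, Known 0 [(38,40),(40,38)], Known 1
    [(19,21),(21,19),(34,38),(36,40),(38,34),(40,36)], Known 2
    [(19,21),(21,19),(34,38),(36,40),(38,36),(40,34)], Cycle 35 142, Cycle 35 206, Cycle 35 174, Cycle 35 238]
    [58,60] Overflow)))))))))))))))))))))))))))"
  by (simp only: eval hexagon_def fused_hexagons_def theta_def)

text \<open>The tree does not branch: each edge to an old vertex closes a cycle of length 4 or 8, or
  a hexagon, and only new vertices remain. At the end the even labels from 2 to 62 are the 31
  vertices at even distance at most 4 from 2.\<close>

lemma check_single_edge: "check [hexagon] single_edge
   (Split 2 [] [5,7] (Split 3 [] [4,6] (Split 5 [Cycle 5 10, Cycle 5 14] [8,10] (Split 7 [Cycle 7 8, Cycle 7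
    12, Cycle 7 10, Cycle 7 14] [12,14] (Split 4 [] [9,11] (Split 6 [Cycle 6 8, Cycle 6 12] [13,15] (Split 8
    [Known 0 [(2,3),(3,2),(4,5),(5,8),(6,15),(7,6)], Known 1 [(2,3),(3,2),(4,5),(5,8),(6,13),(7,6)], Known 2
    [(2,3),(3,2),(4,5),(5,8),(6,11),(7,4)], Known 3 [(2,3),(3,2),(4,5),(5,8),(6,9),(7,4)]] [17,19] (Split 10
    [Cycle 10 8, Cycle 10 12, Known 2 [(2,3),(3,2),(4,5),(5,10),(6,15),(7,6)], Known 3
    [(2,3),(3,2),(4,5),(5,10),(6,13),(7,6)], Known 4 [(2,3),(3,2),(4,5),(5,10),(6,11),(7,4)], Known 5
    [(2,3),(3,2),(4,5),(5,10),(6,9),(7,4)]] [21,23] (Split 12 [Known 0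
    [(2,5),(3,2),(4,7),(5,12),(6,23),(7,10)], Known 1 [(2,5),(3,2),(4,7),(5,12),(6,21),(7,10)], Known 2
    [(2,5),(3,2),(4,7),(5,12),(6,19),(7,8)], Known 3 [(2,5),(3,2),(4,7),(5,12),(6,17),(7,8)], Known 4
    [(2,3),(3,2),(4,7),(5,12),(6,15),(7,6)], Known 5 [(2,3),(3,2),(4,7),(5,12),(6,13),(7,6)], Known 6
    [(2,3),(3,2),(4,7),(5,12),(6,11),(7,4)], Known 7 [(2,3),(3,2),(4,7),(5,12),(6,9),(7,4)]] [25,27] (Split 14
    [Cycle 14 8, Cycle 14 12, Known 2 [(2,5),(3,2),(4,7),(5,14),(6,23),(7,10)], Known 3
    [(2,5),(3,2),(4,7),(5,14),(6,21),(7,10)], Known 4 [(2,5),(3,2),(4,7),(5,14),(6,19),(7,8)], Known 5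
    [(2,5),(3,2),(4,7),(5,14),(6,17),(7,8)], Known 6 [(2,3),(3,2),(4,7),(5,14),(6,15),(7,6)], Known 7
    [(2,3),(3,2),(4,7),(5,14),(6,13),(7,6)], Known 8 [(2,3),(3,2),(4,7),(5,14),(6,11),(7,4)], Known 9
    [(2,3),(3,2),(4,7),(5,14),(6,9),(7,4)]] [29,31] (Split 9 [] [16,18] (Split 11 [Cycle 11 8, Cycle 11 12]
    [20,22] (Split 13 [Known 0 [(2,4),(4,6),(5,13),(6,22),(7,11)], Known 1 [(2,4),(4,6),(5,13),(6,20),(7,11)],
    Known 2 [(2,4),(4,6),(5,13),(6,18),(7,9)], Known 3 [(2,4),(4,6),(5,13),(6,16),(7,9)]] [24,26] (Split 15
    [Cycle 15 8, Cycle 15 12, Known 2 [(2,4),(4,6),(5,15),(6,22),(7,11)], Known 3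
    [(2,4),(4,6),(5,15),(6,20),(7,11)], Known 4 [(2,4),(4,6),(5,15),(6,18),(7,9)], Known 5
    [(2,4),(4,6),(5,15),(6,16),(7,9)]] [28,30] (Split 17 [Cycle 17 142, Cycle 17 206, Cycle 17 174, Cycle 17
    238, Cycle 17 158, Cycle 17 222, Cycle 17 190, Cycle 17 254] [32,34] (Split 19 [Cycle 19 8, Cycle 19 12,
    Cycle 19 142, Cycle 19 206, Cycle 19 174, Cycle 19 238, Cycle 19 158, Cycle 19 222, Cycle 19 190, Cycle 19
    254] [36,38] (Split 21 [Known 0 [(2,8),(3,5),(4,10),(5,21),(6,38),(7,19)], Known 1
    [(2,8),(3,5),(4,10),(5,21),(6,36),(7,19)], Known 2 [(2,8),(3,5),(4,10),(5,21),(6,34),(7,17)], Known 3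
    [(2,8),(3,5),(4,10),(5,21),(6,32),(7,17)], Cycle 21 142, Cycle 21 206, Cycle 21 174, Cycle 21 238, Cycle
    21 158, Cycle 21 222, Cycle 21 190, Cycle 21 254] [40,42] (Split 23 [Cycle 23 8, Cycle 23 12, Known 2
    [(2,8),(3,5),(4,10),(5,23),(6,38),(7,19)], Known 3 [(2,8),(3,5),(4,10),(5,23),(6,36),(7,19)], Known 4
    [(2,8),(3,5),(4,10),(5,23),(6,34),(7,17)], Known 5 [(2,8),(3,5),(4,10),(5,23),(6,32),(7,17)], Cycle 23
    142, Cycle 23 206, Cycle 23 174, Cycle 23 238, Cycle 23 158, Cycle 23 222, Cycle 23 190, Cycle 23 254]
    [44,46] (Split 25 [Cycle 25 134, Cycle 25 198, Cycle 25 166, Cycle 25 230, Cycle 25 150, Cycle 25 214,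
    Cycle 25 182, Cycle 25 246, Cycle 25 142, Cycle 25 206, Cycle 25 174, Cycle 25 238, Cycle 25 158, Cycle 25
    222, Cycle 25 190, Cycle 25 254] [48,50] (Split 27 [Cycle 27 8, Cycle 27 12, Cycle 27 134, Cycle 27 198,
    Cycle 27 166, Cycle 27 230, Cycle 27 150, Cycle 27 214, Cycle 27 182, Cycle 27 246, Cycle 27 142, Cycle 27
    206, Cycle 27 174, Cycle 27 238, Cycle 27 158, Cycle 27 222, Cycle 27 190, Cycle 27 254] [52,54] (Split 29
    [Known 0 [(2,12),(3,7),(4,14),(5,29),(6,54),(7,27)], Known 1 [(2,12),(3,7),(4,14),(5,29),(6,52),(7,27)],
    Known 2 [(2,12),(3,7),(4,14),(5,29),(6,50),(7,25)], Known 3 [(2,12),(3,7),(4,14),(5,29),(6,48),(7,25)],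
    Cycle 29 134, Cycle 29 198, Cycle 29 166, Cycle 29 230, Cycle 29 150, Cycle 29 214, Cycle 29 182, Cycle 29
    246, Cycle 29 142, Cycle 29 206, Cycle 29 174, Cycle 29 238, Cycle 29 158, Cycle 29 222, Cycle 29 190,
    Cycle 29 254] [56,58] (Split 31 [Cycle 31 8, Cycle 31 12, Known 2
    [(2,12),(3,7),(4,14),(5,31),(6,54),(7,27)], Known 3 [(2,12),(3,7),(4,14),(5,31),(6,52),(7,27)], Known 4
    [(2,12),(3,7),(4,14),(5,31),(6,50),(7,25)], Known 5 [(2,12),(3,7),(4,14),(5,31),(6,48),(7,25)], Cycle 31
    134, Cycle 31 198, Cycle 31 166, Cycle 31 230, Cycle 31 150, Cycle 31 214, Cycle 31 182, Cycle 31 246,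
    Cycle 31 142, Cycle 31 206, Cycle 31 174, Cycle 31 238, Cycle 31 158, Cycle 31 222, Cycle 31 190, Cycle 31
    254] [60,62] Overflow))))))))))))))))))))))"
  by (simp only: eval single_edge_def hexagon_def)

section \<open>From the refuted edge to the empty graph\<close>

text \<open>A vertex would have a neighbour by the degree condition, and the edge between them
  realizes \<open>single_edge\<close>.\<close>

lemma (in bipartite_cubic) V_empty: "V = {}"
proof (rule ccontr)
  assume "V \<noteq> {}"
  then obtain v where v: "v \<in> V" by auto
  then obtain w where vw: "adj v w" using degree[OF v] by fastforce
  have th: "excluded theta"
    by (rule check_sound(1)[OF _ well_formed_configs(1) check_theta]) simp
  then have fu: "excluded fused_hexagons"
    by (intro check_sound(1)[OF _ well_formed_configs(2) check_fused_hexagons]) simp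
  with th have hx: "excluded hexagon"
    by (intro check_sound(1)[OF _ well_formed_configs(3) check_hexagon]) simp
  then have "excluded single_edge"
    by (intro check_sound(1)[OF _ well_formed_configs(4) check_single_edge]) simp
  \<comment> \<open>The label 3 goes to \<open>w\<close> and 2 to \<open>v\<close>, so odd labels
    are on the left exactly when \<open>w\<close> is; this determines the side bit.\<close>
  moreover have "realizes (\<lambda>x. if odd_num x then w else v) (left w) single_edge"
    using v adj_V[OF adj_sym[OF vw]] vw adj_sym[OF vw] adj_left[OF vw]
    by (auto simp: realizes_def single_edge_def)
  ultimately show False by (auto simp: excluded_def)
qed

section \<open>Passing to directed graphs\<close>

text \<open>The search yields cycles as vertex lists, whereas \<open>cycle\<close> is about lists of
  arcs; an arc is picked for each adjacency.\<close>

lemma (in wf_digraph) awalk_of_verts: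
  assumes "x \<in> verts G" "successively (\<lambda>u v. u \<rightarrow>\<^bsub>G\<^esub> v) (x # xs)"
  shows "\<exists>p. awalk x p (last (x # xs)) \<and> awalk_verts x p = x # xs"
  using assms
proof (induction xs arbitrary: x)
  case Nil
  then show ?case by (intro exI[of _ "[]"]) (simp add: awalk_Nil_iff)
next
  case (Cons y ys)
  then obtain e where e: "e \<in> arcs G" "tail G e = x" "head G e = y" by auto
  then have "y \<in> verts G" by auto
  with Cons obtain p where "awalk y p (last (y # ys))" "awalk_verts y p = y # ys" by auto
  with e show ?case by (intro exI[of _ "e # p"]) (simp add: awalk_Cons_iff)
qed

lemma (in wf_digraph) simple_cycle_of_verts:
  assumes "distinct xs" "successively (\<lambda>u v. u \<rightarrow>\<^bsub>G\<^esub> v) xs" "last xs \<rightarrow>\<^bsub>G\<^esub> hd xs" "3 \<le> length xs"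
  shows "\<exists>p. simple_cycle G p \<and> length p = length xs"
proof -
  obtain x ys where xs: "xs = x # ys" using assms(4) by (cases xs) auto
  \<comment> \<open>The first vertex is repeated at the end to close the walk.\<close>
  have "successively (\<lambda>u v. u \<rightarrow>\<^bsub>G\<^esub> v) (x # (ys @ [x]))"
    using assms(2,3) xs successively_append_iff[of _ "x # ys" "[x]"] by simp
  moreover have "x \<in> verts G" using adj_in_verts(2)[OF assms(3)] xs by simp
  ultimately obtain p where p: "awalk x p x" "awalk_verts x p = x # ys @ [x]"
    using awalk_of_verts[of x "ys @ [x]"] by auto
  \<comment> \<open>A walk has one more vertex than arcs, so the repeated vertex makes the number of
    arcs equal to the length of \<open>xs\<close>.\<close>
  have len: "length p = length xs" using arg_cong[OF p(2), of length] xs by (simp add: length_awalk_verts)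
  then have "cycle p" using p assms(1) xs by (auto simp: cycle_def)
  then show ?thesis using len assms(4) by (auto simp: simple_cycle_def)
qed

text \<open>Without parallel arcs, an arc leaving \<open>v\<close> is determined by its
  head.\<close>

lemma (in graph) card_dominated:
  "card {w. v \<rightarrow>\<^bsub>G\<^esub> w} = out_degree G v"
proof -
  have "{w. v \<rightarrow>\<^bsub>G\<^esub> w} = head G ` out_arcs G v" by (auto simp: arcs_ends_conv)
  moreover have "inj_on (head G) (out_arcs G v)"
    by (auto simp: inj_on_def arc_to_ends_def intro: no_multi_arcs)
  ultimately show ?thesis by (simp add: card_image out_degree_def)
qed

section \<open>Equal sides and the lower bound\<close>

text \<open>Counting the edges from either side gives three times the size of that side.\<close>

lemma cubic_bipartite_balanced:
  assumes "finite A" "finite B"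
    and "\<And>a. a \<in> A \<Longrightarrow> card {b \<in> B. R a b} = (3 :: nat)" "\<And>b. b \<in> B \<Longrightarrow> card {a \<in> A. R a b} = 3"
  shows "card A = card B"
  using sum_multicount[of A B R 3] assms by simp

theorem corollary2:
  fixes G :: "('a, 'b) pre_digraph"
  assumes "erdos_gyarfas_counterexample G"
    and "cubic G"
    and "bipartite G"
  shows "card (verts G) \<ge> 60"
proof (rule ccontr)
  assume "\<not> 60 \<le> card (verts G)"
  then have less: "card (verts G) < 60" by simp
  interpret graph G using assms(1) by (simp add: erdos_gyarfas_counterexample_def)
  from assms(3) obtain A B where AB: "A \<union> B = verts G" "A \<inter> B = {}"
    and arcs: "\<forall>e \<in> arcs G. tail G e \<in> A \<and> head G e \<in> B \<or> tail G e \<in> B \<and> head G e \<in> A"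
    unfolding bipartite_def by (elim exE conjE)
  have ends: "u \<in> A \<and> v \<in> B \<or> u \<in> B \<and> v \<in> A" if uv: "u \<rightarrow>\<^bsub>G\<^esub> v" for u v
  proof -
    obtain e where "e \<in> arcs G" "tail G e = u" "head G e = v" using uv by (rule reachableE)
    then show ?thesis using arcs by metis
  qed
  have "finite (A \<union> B)" by (simp add: AB(1))
  then have fin: "finite A" "finite B" by simp_all
  have sub: "A \<subseteq> verts G" "B \<subseteq> verts G" using AB(1) by blast+
  have sym: "v \<rightarrow>\<^bsub>G\<^esub> u" if "u \<rightarrow>\<^bsub>G\<^esub> v" for u v
    using arcs_ends_symmetric[OF sym_arcs that] .
  have deg: "card {w. v \<rightarrow>\<^bsub>G\<^esub> w} = 3" if "v \<in> verts G" for v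
    using assms(2) that by (simp add: cubic_def card_dominated)
  have "card A = card B"
  proof (rule cubic_bipartite_balanced[OF fin, where R = "\<lambda>u v. u \<rightarrow>\<^bsub>G\<^esub> v"])
    fix a assume a: "a \<in> A"
    have "{b \<in> B. a \<rightarrow>\<^bsub>G\<^esub> b} = {w. a \<rightarrow>\<^bsub>G\<^esub> w}" using ends[of a] a AB(2) by blast
    then show "card {b \<in> B. a \<rightarrow>\<^bsub>G\<^esub> b} = 3" using deg[of a] a sub(1) by auto
  next
    fix b assume b: "b \<in> B"
    have "{a \<in> A. a \<rightarrow>\<^bsub>G\<^esub> b} = {w. b \<rightarrow>\<^bsub>G\<^esub> w}" using ends[of b] sym[of _ b] sym[of b] b AB(2) by blast
    then show "card {a \<in> A. a \<rightarrow>\<^bsub>G\<^esub> b} = 3" using deg[of b] b sub(2) by auto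
  qed
  moreover have "card A + card B = card (verts G)"
    using card_Un_disjoint[OF fin AB(2)] AB(1) by simp
  \<comment> \<open>Two equal sides with at most 59 vertices together have at most 29 each; this is
    the bound in \<open>overflow\<close>.\<close>
  ultimately have small: "card A \<le> 29" "card B \<le> 29" using less by auto
  \<comment> \<open>The part \<open>A\<close> plays the left side. The interpretation makes the
    vertex set empty, against the definition of a counterexample.\<close>
  interpret bipartite_cubic "verts G" "\<lambda>u v. u \<rightarrow>\<^bsub>G\<^esub> v" "\<lambda>v. v \<in> A"
  proof
    show "finite (verts G)" by simp
    show "v \<rightarrow>\<^bsub>G\<^esub> u" "u \<in> verts G" "(u \<in> A) \<noteq> (v \<in> A)" if "u \<rightarrow>\<^bsub>G\<^esub> v" for u v
      using sym[OF that] adj_in_verts(1)[OF that] ends[OF that] AB(2) by auto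
    show "card {w. v \<rightarrow>\<^bsub>G\<^esub> w} = 3" if "v \<in> verts G" for v
      using deg[OF that] .
    show "card {v \<in> verts G. (v \<in> A) = b} \<le> 29" for b
    proof -
      have "{v \<in> verts G. (v \<in> A) = b} = (if b then A else B)" using AB by auto
      then show ?thesis using small by simp
    qed
    show "length xs \<notin> {4, 8, 16}"
      if xs: "xs \<noteq> []" "distinct xs" "successively (\<lambda>u v. u \<rightarrow>\<^bsub>G\<^esub> v) xs" "last xs \<rightarrow>\<^bsub>G\<^esub> hd xs" for xs
    proof
      assume "length xs \<in> {4, 8, 16}"
      then have "3 \<le> length xs" and "length xs = 2 ^ 2 \<or> length xs = 2 ^ 3 \<or> length xs = 2 ^ 4" by auto
      then obtain k where k: "length xs = 2 ^ k" by blast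
      obtain p where "simple_cycle G p" "length p = length xs"
        using simple_cycle_of_verts[OF xs(2-4) \<open>3 \<le> length xs\<close>] by blast
      then show False using assms(1) k by (auto simp: erdos_gyarfas_counterexample_def)
    qed
  qed
  show False using V_empty assms(1) by (simp add: erdos_gyarfas_counterexample_def)
qed

end
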